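(* For all $\alpha,\beta>-1$, $t>0$ and $\theta,\varphi\in[0,\pi]$, \begin{align*} \mathbb{H}_t^{\alpha,\beta}(\theta,\varphi) &=4\iint_{(0,1]^2}\Big(\Psi_E^{\alpha,\beta}(t,\theta,\varphi,u,v)-\Psi_E^{\alpha,\beta}(t,\theta,\varphi,u,1)-\Psi_E^{\alpha,\beta}(t,\theta,\varphi,1,v)+\Psi_E^{\alpha,\beta}(t,\theta,\varphi,1,1)\Big)\,d\Pi_\alpha(u)\,d\Pi_\beta(v)\\ &\quad+2\int_{(0,1]}\Big(\Psi_E^{\alpha,\beta}(t,\theta,\varphi,u,1)-\Psi_E^{\alpha,\beta}(t,\theta,\varphi,1,1)\Big)\,d\Pi_\alpha(u)\\ &\quad+2\int_{(0,1]}\Big(\Psi_E^{\alpha,\beta}(t,\theta,\varphi,1,v)-\Psi_E^{\alpha,\beta}(t,\theta,\varphi,1,1)\Big)\,d\Pi_\beta(v)\\ &\quad+\Psi_E^{\alpha,\beta}(t,\theta,\varphi,1,1). \end{align*}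
   Context: For $\alpha,\beta>-1$ let $d\mu_{\alpha,\beta}(\theta)=(\sin\frac{\theta}{2})^{2\alpha+1}(\cos\frac{\theta}{2})^{2\beta+1}\,d\theta$ on $[0,\pi]$. Let $\mathcal{P}_n^{\alpha,\beta}(\theta)$, $n\ge 0$, be the classical Jacobi trigonometric polynomials (the Jacobi polynomial of degree $n$ and type $(\alpha,\beta)$ evaluated at $\cos\theta$), normalized in $L^2(d\mu_{\alpha,\beta})$. Define $$\mathbb{H}_t^{\alpha,\beta}(\theta,\varphi)=\sum_{n=0}^\infty e^{-t\left(n+\frac{\alpha+\beta+1}{2}\right)}\mathcal{P}_n^{\alpha,\beta}(\theta)\mathcal{P}_n^{\alpha,\beta}(\varphi),\qquad t>0,\ \theta,\varphi\in[0,\pi].$$ Let $c_{\alpha,\beta}=\dfrac{\Gamma(\alpha+\beta+2)}{2^{\alpha+\beta+1}\Gamma(\alpha+1)\Gamma(\beta+1)}$, $q(\theta,\varphi,u,v)=1-u\sin\frac{\theta}{2}\sin\frac{\varphi}{2}-v\cos\frac{\theta}{2}\cos\frac{\varphi}{2}$, $$\Psi^{\alpha,\beta}(t,\theta,\varphi,u,v)=\frac{c_{\alpha,\beta}\sinh\frac t2}{(\cosh\frac t2-1+q(\theta,\varphi,u,v))^{\alpha+\beta+2}},$$ and let $\Psi_E^{\alpha,\beta}$ be its symmetrization $$\Psi_E^{\alpha,\beta}(t,\theta,\varphi,u,v)=\frac14\sum_{\xi,\eta=\pm1}\Psi^{\alpha,\beta}(t,\theta,\varphi,\xi u,\eta v).$$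 For $\alpha>-1$, $\alpha\ne-1/2$, $d\Pi_\alpha$ is the (local, possibly negative and non-finite near $\pm1$) measure on $(-1,1)$ given by $$d\Pi_\alpha(u)=\frac{\Gamma(\alpha+1)}{\sqrt\pi\,\Gamma(\alpha+1/2)}(1-u^2)^{\alpha-1/2}\,du.$$ For $\alpha>-1/2$ it is a probability measure; for $-1<\alpha<-1/2$ its density is negative and not integrable on $(-1,1)$. For $\alpha=-1/2$, $d\Pi_{-1/2}=\frac12(\delta_{-1}+\delta_1)$, with $\delta_{\pm1}$ the point mass at $\pm1$. When the parameter $\alpha$ differs from $-1/2$, integration over $(0,1]$ with respect to $d\Pi_\alpha(u)$ means integration over $(0,1)$ against the density $\frac{\Gamma(\alpha+1)}{\sqrt\pi\,\Gamma(\alpha+1/2)}(1-u^2)^{\alpha-1/2}$ (and likewise for $d\Pi_\beta(v)$, with $\beta$ and $v$ in place of $\alpha$ and $u$). *)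

theory Defs
  imports "HOL-Analysis.Analysis"
begin

text \<open>The measure \<open>d\<mu>\<close> on \<open>[0,\<pi>]\<close>.\<close>

definition jacobi_measure :: "real \<Rightarrow> real \<Rightarrow> real measure" where
  "jacobi_measure \<alpha> \<beta> = density lborel
     (\<lambda>\<theta>. indicator {0..pi} \<theta> *
        ennreal (sin (\<theta> / 2) powr (2 * \<alpha> + 1) * cos (\<theta> / 2) powr (2 * \<beta> + 1)))"

text \<open>The classical Jacobi polynomial of degree \<open>n\<close> and type \<open>(\<alpha>,\<beta>)\<close>, in the explicit form
  obtained from Rodrigues' formula by the Leibniz rule.\<close>

definition jacobi_poly :: "real \<Rightarrow> real \<Rightarrow> nat \<Rightarrow> real \<Rightarrow> real" where
  "jacobi_poly \<alpha> \<beta> n x =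
     (\<Sum>s\<le>n. ((real n + \<alpha>) gchoose (n - s)) * ((real n + \<beta>) gchoose s)
        * ((x - 1) / 2) ^ s * ((x + 1) / 2) ^ (n - s))"

definition jacobi_trig :: "real \<Rightarrow> real \<Rightarrow> nat \<Rightarrow> real \<Rightarrow> real" where
  "jacobi_trig \<alpha> \<beta> n \<theta> = jacobi_poly \<alpha> \<beta> n (cos \<theta>) /
     sqrt (LINT \<phi>|jacobi_measure \<alpha> \<beta>. (jacobi_poly \<alpha> \<beta> n (cos \<phi>))\<^sup>2)"

definition jacobi_kernel_term ::
    "real \<Rightarrow> real \<Rightarrow> real \<Rightarrow> real \<Rightarrow> real \<Rightarrow> nat \<Rightarrow> real" where
  "jacobi_kernel_term \<alpha> \<beta> t \<theta> \<phi> n =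
     exp (- t * (real n + (\<alpha> + \<beta> + 1) / 2)) * jacobi_trig \<alpha> \<beta> n \<theta> * jacobi_trig \<alpha> \<beta> n \<phi>"

definition jacobi_kernel :: "real \<Rightarrow> real \<Rightarrow> real \<Rightarrow> real \<Rightarrow> real \<Rightarrow> real" where
  "jacobi_kernel \<alpha> \<beta> t \<theta> \<phi> = (\<Sum>n. jacobi_kernel_term \<alpha> \<beta> t \<theta> \<phi> n)"

definition c_const :: "real \<Rightarrow> real \<Rightarrow> real" where
  "c_const \<alpha> \<beta> = Gamma (\<alpha> + \<beta> + 2) /
     (2 powr (\<alpha> + \<beta> + 1) * Gamma (\<alpha> + 1) * Gamma (\<beta> + 1))"

definition q_fun :: "real \<Rightarrow> real \<Rightarrow> real \<Rightarrow> real \<Rightarrow> real" where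
  "q_fun \<theta> \<phi> u v = 1 - u * sin (\<theta> / 2) * sin (\<phi> / 2) - v * cos (\<theta> / 2) * cos (\<phi> / 2)"

definition Psi :: "real \<Rightarrow> real \<Rightarrow> real \<Rightarrow> real \<Rightarrow> real \<Rightarrow> real \<Rightarrow> real \<Rightarrow> real" where
  "Psi \<alpha> \<beta> t \<theta> \<phi> u v = c_const \<alpha> \<beta> * sinh (t / 2) /
     (cosh (t / 2) - 1 + q_fun \<theta> \<phi> u v) powr (\<alpha> + \<beta> + 2)"

definition Psi_E :: "real \<Rightarrow> real \<Rightarrow> real \<Rightarrow> real \<Rightarrow> real \<Rightarrow> real \<Rightarrow> real \<Rightarrow> real" where
  "Psi_E \<alpha> \<beta> t \<theta> \<phi> u v =
     1 / 4 * (\<Sum>\<xi>\<in>{-1, 1}. \<Sum>\<eta>\<in>{-1, 1}. Psi \<alpha> \<beta> t \<theta> \<phi> (\<xi> * u) (\<eta> * v))"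

text \<open>For \<open>-1 < \<alpha> < -1/2\<close> the local measure \<open>d\<Pi>\<close> is negative with infinite mass near \<open>\<plusminus>1\<close>, so it
  is not of type \<open>real measure\<close>. It is represented as a real density \<open>Pi_density \<alpha>\<close> with respect
  to a positive sigma-finite reference measure \<open>Pi_ref \<alpha>\<close>: Lebesgue measure on \<open>(-1,1)\<close> if
  \<open>\<alpha> \<noteq> -1/2\<close>, and the two half point masses at \<open>\<plusminus>1\<close> (with density 1) if \<open>\<alpha> = -1/2\<close>.\<close>

definition Pi_ref :: "real \<Rightarrow> real measure" where
  "Pi_ref \<alpha> =
     (if \<alpha> = - 1 / 2 then distr (point_measure {-1, 1} (\<lambda>_. 1 / 2)) borel (\<lambda>u. u)
      else density lborel (indicator {-1<..<1}))"

definition Pi_density :: "real \<Rightarrow> real \<Rightarrow> real" where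
  "Pi_density \<alpha> u =
     (if \<alpha> = - 1 / 2 then 1
      else Gamma (\<alpha> + 1) / (sqrt pi * Gamma (\<alpha> + 1 / 2)) * (1 - u\<^sup>2) powr (\<alpha> - 1 / 2))"

text \<open>Existence and value of the integral of \<open>f\<close> over \<open>A\<close> with respect to \<open>d\<Pi>\<close>, and of the
  double integral with respect to the product, as Lebesgue integrals.\<close>

definition Pi_integrable :: "real \<Rightarrow> real set \<Rightarrow> (real \<Rightarrow> real) \<Rightarrow> bool" where
  "Pi_integrable \<alpha> A f \<longleftrightarrow> set_integrable (Pi_ref \<alpha>) A (\<lambda>u. f u * Pi_density \<alpha> u)"

definition Pi_integral :: "real \<Rightarrow> real set \<Rightarrow> (real \<Rightarrow> real) \<Rightarrow> real" where
  "Pi_integral \<alpha> A f = (LINT u:A|Pi_ref \<alpha>. f u * Pi_density \<alpha> u)"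

definition Pi_integrable2 ::
    "real \<Rightarrow> real \<Rightarrow> (real \<times> real) set \<Rightarrow> (real \<Rightarrow> real \<Rightarrow> real) \<Rightarrow> bool" where
  "Pi_integrable2 \<alpha> \<beta> A f \<longleftrightarrow> set_integrable (Pi_ref \<alpha> \<Otimes>\<^sub>M Pi_ref \<beta>) A
     (\<lambda>(u, v). f u v * Pi_density \<alpha> u * Pi_density \<beta> v)"

definition Pi_integral2 ::
    "real \<Rightarrow> real \<Rightarrow> (real \<times> real) set \<Rightarrow> (real \<Rightarrow> real \<Rightarrow> real) \<Rightarrow> real" where
  "Pi_integral2 \<alpha> \<beta> A f = (LINT p:A|Pi_ref \<alpha> \<Otimes>\<^sub>M Pi_ref \<beta>.
     (case p of (u, v) \<Rightarrow> f u v * Pi_density \<alpha> u * Pi_density \<beta> v))"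

end

theory Submission
  imports Defs "HOL-Real_Asymp.Real_Asymp"
begin

text \<open>Put \<open>a = sin\<^sup>2 (\<theta>/2)\<close>, \<open>b = sin\<^sup>2 (\<phi>/2)\<close>, \<open>r = e\<^bsup>-t\<^esup>\<close> and \<open>k = cosh (t/2)\<close>. The binomial series expands
  \<open>\<Psi>\<^sub>E\<close> in the even powers \<open>u\<^bsup>2i\<^esup> v\<^bsup>2j\<^esup>\<close> with nonnegative coefficients, and
  \<open>2 \<integral>\<^bsub>(0,1]\<^esub> (u\<^bsup>2i\<^esup> - 1) d\<Pi>\<^sub>\<alpha> = (1/2)\<^sub>i / (\<alpha>+1)\<^sub>i - 1\<close> for every \<open>\<alpha> > -1\<close>. Hence the right-hand side is, up to a
  factor, Appell's series \<open>F\<^sub>4\<close> at \<open>(a b / k\<^sup>2, (1 - a) (1 - b) / k\<^sup>2)\<close>, for all parameters at once and without analytic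
  continuation. The homogeneous parts of this series are finite combinations of the products
  \<open>P\<^sub>n(\<theta>) P\<^sub>n(\<phi>)\<close> with positive binomial coefficients, as one sees by applying the Jacobi operator. Since
  \<open>1 / (4 k\<^sup>2) = r / (1 + r)\<^sup>2\<close>, interchanging the two summations with
  \<open>\<Sum>\<^sub>m binom(2m+\<mu>, m) (r / (1 + r)\<^sup>2)\<^sup>m = (1 + r)\<^bsup>\<mu>+1\<^esup> / (1 - r)\<close> gives the Poisson kernel.\<close>

section \<open>Jacobi polynomials\<close>

text \<open>The weights 4, 2, 2, 1 on the right-hand side are those of a product: if
  \<open>I\<close> and \<open>J\<close> are the integrals over (0,1] of \<open>u^(2i) - 1\<close>
  and \<open>v^(2j) - 1\<close>, then \<open>4 I J + 2 I + 2 J + 1 = (1 + 2 I) (1 + 2 J)\<close>.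
  Each even monomial thus contributes one factor per parameter, and these factors are quotients of
  Pochhammer symbols. The subtraction of the value at 1 makes the integrals exist: for
  \<open>\<alpha> < -1/2\<close> the density behaves like a power below -1 at the endpoint, and
  \<open>1 - u^(2i)\<close> supplies a factor \<open>1 - u^2\<close>. The obstacle is the
  interchange of sum and integral, since the obvious majorant, the density itself, then has infinite
  integral. What helps is that no single integrand changes sign. Its absolute integral is therefore
  known exactly, grows at most linearly in the degree, and loses against the geometric decay of the
  powers of \<open>1 / cosh (t/2)\<close>.\<close>

lemma alternating_sum_pochhammer:
  fixes c :: real
  assumes "k \<le> n"
  shows "(\<Sum>i\<le>n. (-1) ^ i * real (n choose i) * pochhammer (c + real i) k) =
         (if k < n then 0 else (-1) ^ n * fact n)"
  using assms
proof (induction n arbitrary: c k)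
  case 0
  then show ?case by simp
next
  case (Suc n)
  let ?S = "\<lambda>n c k. \<Sum>i\<le>n. (-1) ^ i * real (n choose i) * pochhammer (c + real i) k"
  \<comment> \<open>By Pascal's rule a step in \<open>n\<close> is a difference in \<open>c\<close>.
    It lowers the degree of \<open>pochhammer\<close> in \<open>c\<close> by one, so that after
    \<open>n\<close> steps only \<open>k = n\<close> leaves something.\<close>
  have *: "?S (Suc n) c k = ?S n c k - ?S n (c + 1) k"
  proof -
    have "?S (Suc n) c k = pochhammer c k +
        (\<Sum>i\<le>n. (-1) ^ Suc i * real (Suc n choose Suc i) * pochhammer (c + real (Suc i)) k)"
      by (subst sum.atMost_Suc_shift) simp
    also have "\<dots> = pochhammer c k
        + (\<Sum>i\<le>n. (-1) ^ Suc i * real (n choose Suc i) * pochhammer (c + real (Suc i)) k)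
        - ?S n (c + 1) k"
      by (simp add: sum.distrib algebra_simps sum_subtractf sum_negf)
    also have "pochhammer c k
        + (\<Sum>i\<le>n. (-1) ^ Suc i * real (n choose Suc i) * pochhammer (c + real (Suc i)) k)
        = (\<Sum>i\<le>Suc n. (-1) ^ i * real (n choose i) * pochhammer (c + real i) k)"
      by (subst sum.atMost_Suc_shift) simp
    finally show ?thesis by simp
  qed
  show ?case
  proof (cases k)
    case 0
    show ?thesis
      using choose_alternating_sum[of "Suc n", where ?'a = real] by (simp add: 0 del: sum.atMost_Suc binomial_Suc_Suc)
  next
    case (Suc j)
    have "?S n c k - ?S n (c + 1) k =
      (\<Sum>i\<le>n. (-1) ^ i * real (n choose i) * (pochhammer (c + real i) (Suc j) - pochhammer (c + 1 + real i) (Suc j)))"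
      by (simp add: Suc sum_subtractf algebra_simps)
    also have "\<dots> = (\<Sum>i\<le>n. (-1) ^ i * real (n choose i) * (- real (Suc j) * pochhammer (c + 1 + real i) j))"
    proof (rule sum.cong[OF refl])
      fix i
      have "pochhammer (c + real i) (Suc j) - pochhammer (c + 1 + real i) (Suc j)
         = - real (Suc j) * pochhammer (c + 1 + real i) j"
        by (simp only: pochhammer_rec[of "c + real i"] pochhammer_Suc[of "c + 1 + real i" j])
           (simp add: algebra_simps)
      then show "(-1) ^ i * real (n choose i) * (pochhammer (c + real i) (Suc j) - pochhammer (c + 1 + real i) (Suc j))
        = (-1) ^ i * real (n choose i) * (- real (Suc j) * pochhammer (c + 1 + real i) j)" by simp
    qed
    also have "\<dots> = - real (Suc j) * ?S n (c + 1) j"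
      by (simp add: sum_distrib_left mult_ac)
    also have "\<dots> = (if k < Suc n then 0 else (-1) ^ Suc n * fact (Suc n))"
      using Suc.prems Suc by (subst Suc.IH) (auto simp: algebra_simps)
    finally show ?thesis
      unfolding * .
  qed
qed

lemma smult_sum_right: "smult c (\<Sum>i\<in>A. f i) = (\<Sum>i\<in>A. smult c (f i))"
  by (induction A rule: infinite_finite_induct) (auto simp: smult_add_right)

text \<open>Bernstein products without binomial factors. With \<open>x\<close> the squared sine of
  the half angle, \<open>1 - x\<close> is the squared cosine, so both the Jacobi polynomials and the
  kernel are naturally written in this form.\<close>

definition bernstein :: "nat \<Rightarrow> nat \<Rightarrow> real poly" where
  "bernstein i j = [:0, 1:] ^ i * [:1, -1:] ^ j"

lemma poly_bernstein [simp]: "poly (bernstein i j) x = x ^ i * (1 - x) ^ j"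
  by (simp add: bernstein_def poly_power)

lemma degree_bernstein: "degree (bernstein i j) = i + j"
  by (simp add: bernstein_def degree_mult_eq degree_power_eq)

lemma coeff_bernstein_top: "coeff (bernstein i j) (i + j) = (-1) ^ j"
proof -
  have "lead_coeff (bernstein i j) = (-1) ^ j"
    by (simp add: bernstein_def lead_coeff_mult lead_coeff_power)
  then show ?thesis
    by (simp add: degree_bernstein)
qed

section \<open>The hypergeometric operator and its eigenpolynomials\<close>

locale jacobi =
  fixes \<alpha> \<beta> :: real
  assumes \<alpha>: "\<alpha> > -1" and \<beta>: "\<beta> > -1"
begin

text \<open>The Jacobi operator in the variable \<open>x\<close> with \<open>cos \<theta> = 1 - 2 x\<close>, i.e. the hypergeometric operator.\<close>

definition jacobi_op :: "real poly \<Rightarrow> real poly" where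
  "jacobi_op p = [:0, 1, -1:] * pderiv (pderiv p) + [:\<alpha> + 1, - (\<alpha> + \<beta> + 2):] * pderiv p"

text \<open>On monomials the operator is bidiagonal; its diagonal entries are the
  eigenvalues.\<close>

lemma coeff_jacobi_op:
  "coeff (jacobi_op p) k = real (k + 1) * (real k + \<alpha> + 1) * coeff p (k + 1)
     - real k * (real k + \<alpha> + \<beta> + 1) * coeff p k"
  by (cases k) (auto simp: jacobi_op_def coeff_pderiv coeff_pCons algebra_simps split: nat.splits)

lemma jacobi_op_add: "jacobi_op (p + q) = jacobi_op p + jacobi_op q"
  by (intro poly_eqI) (simp add: coeff_jacobi_op algebra_simps)

lemma jacobi_op_smult: "jacobi_op (smult c p) = smult c (jacobi_op p)"
  by (intro poly_eqI) (simp add: coeff_jacobi_op algebra_simps)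

lemma jacobi_op_diff: "jacobi_op (p - q) = jacobi_op p - jacobi_op q"
  by (intro poly_eqI) (simp add: coeff_jacobi_op algebra_simps)

lemma jacobi_op_0 [simp]: "jacobi_op 0 = 0"
  by (simp add: jacobi_op_def)

lemma jacobi_op_sum: "jacobi_op (\<Sum>i\<in>A. f i) = (\<Sum>i\<in>A. jacobi_op (f i))"
  by (induction A rule: infinite_finite_induct) (auto simp: jacobi_op_add)

definition jacobi_eig :: "nat \<Rightarrow> real" where
  "jacobi_eig n = real n * (real n + \<alpha> + \<beta> + 1)"

text \<open>The difference factors as \<open>(m - n) (m + n + \<alpha> + \<beta> + 1)\<close>. Here
  \<open>\<alpha> + \<beta> + 1\<close> may be negative but exceeds -1, and distinct naturals have
  sum at least 1.\<close>

lemma jacobi_eig_inj: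
  assumes "jacobi_eig m = jacobi_eig n" shows "m = n"
proof (rule ccontr)
  assume "m \<noteq> n"
  then have "real m + real n \<ge> 1"
    by linarith
  then have "real m + real n + \<alpha> + \<beta> + 1 > 0"
    using \<alpha> \<beta> by linarith
  moreover have "(real m - real n) * (real m + real n + \<alpha> + \<beta> + 1) = jacobi_eig m - jacobi_eig n"
    by (simp add: jacobi_eig_def algebra_simps)
  ultimately show False
    using assms \<open>m \<noteq> n\<close> by auto
qed

text \<open>Comparing leading coefficients shows that the degree \<open>d\<close> of a nonzero
  solution has the same eigenvalue as \<open>n\<close>. Then \<open>d = n\<close>, and the
  coefficient assumed to vanish would be the leading one.\<close>

lemma eigenpoly_unique:
  assumes "jacobi_op p = smult (- jacobi_eig n) p" "degree p \<le> n" "coeff p n = 0"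
  shows "p = 0"
proof (rule ccontr)
  assume p: "p \<noteq> 0"
  define d where "d = degree p"
  have "coeff p d \<noteq> 0" "coeff p (d + 1) = 0"
    using p by (auto simp: d_def coeff_eq_0)
  moreover have "coeff (jacobi_op p) d = - jacobi_eig n * coeff p d"
    using assms(1) by simp
  ultimately have "jacobi_eig d = jacobi_eig n"
    by (simp add: coeff_jacobi_op jacobi_eig_def)
  then show False
    using jacobi_eig_inj assms(3) \<open>coeff p d \<noteq> 0\<close> by blast
qed

text \<open>Truncated subtraction does no harm: \<open>i - 1\<close> and \<open>j - 1\<close> come
  with the factors \<open>i\<close> and \<open>j\<close>.\<close>

lemma jacobi_op_bernstein:
  "jacobi_op (bernstein i j) = smult (- jacobi_eig (i + j)) (bernstein i j)
     + smult (real i * (real i + \<alpha>)) (bernstein (i - 1) j)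
     + smult (real j * (real j + \<beta>)) (bernstein i (j - 1))"
proof -
  have X: "pderiv ([:0, 1:] ^ k :: real poly) = smult (real k) ([:0, 1:] ^ (k - 1))" for k
    by (cases k) (auto simp: pderiv_power_Suc pderiv_pCons simp del: power_Suc)
  have Y: "pderiv ([:1, -1:] ^ k :: real poly) = smult (- real k) ([:1, -1:] ^ (k - 1))" for k
    by (cases k) (auto simp: pderiv_power_Suc pderiv_pCons simp del: power_Suc)
  have "poly (jacobi_op (bernstein i j)) x = poly (smult (- jacobi_eig (i + j)) (bernstein i j)
     + smult (real i * (real i + \<alpha>)) (bernstein (i - 1) j)
     + smult (real j * (real j + \<beta>)) (bernstein i (j - 1))) x" for x
  proof -
    \<comment> \<open>\<open>A1\<close>, \<open>A2\<close> are the derivatives of \<open>A\<close>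
      in \<open>x\<close>, and \<open>B1\<close>, \<open>B2\<close> those of \<open>B\<close> in
      \<open>1 - x\<close>. The relations proved next absorb all exponents, so that the claim
      becomes a polynomial identity in these six quantities.\<close>
    define A A1 A2 where "A = x ^ i" "A1 = real i * x ^ (i - 1)" "A2 = real i * (real (i - 1) * x ^ (i - 1 - 1))"
    define B B1 B2 where "B = (1 - x) ^ j" "B1 = real j * (1 - x) ^ (j - 1)" "B2 = real j * (real (j - 1) * (1 - x) ^ (j - 1 - 1))"
    note defs = A_A1_A2_def B_B1_B2_def
    have A: "x * A1 = real i * A" "x * A2 = (real i - 1) * A1"
      by (cases i; cases "i - 1"; simp add: defs)+
    have B: "x * B1 = B1 - real j * B" "x * B2 = B2 - (real j - 1) * B1"
      by (cases j; cases "j - 1"; simp add: defs algebra_simps)+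
    have "poly (jacobi_op (bernstein i j)) x = x * (1 - x) * (A2 * B - 2 * A1 * B1 + A * B2)
        + (\<alpha> + 1 - (\<alpha> + \<beta> + 2) * x) * (A1 * B - A * B1)"
      by (simp add: jacobi_op_def bernstein_def pderiv_mult pderiv_add pderiv_diff pderiv_smult X Y poly_power defs)
         (simp add: algebra_simps)
    also have "\<dots> = - jacobi_eig (i + j) * (A * B) + (real i + \<alpha>) * A1 * B + (real j + \<beta>) * A * B1"
      using A B unfolding jacobi_eig_def of_nat_add by algebra
    finally show ?thesis
      by (simp add: defs algebra_simps)
  qed
  then show ?thesis
    by (simp add: poly_eq_poly_eq_iff[symmetric] fun_eq_iff)
qed

text \<open>The denominator is chosen so that the factors \<open>i (i + \<alpha>)\<close> and
  \<open>j (j + \<beta>)\<close> produced by \<open>jacobi_op_bernstein\<close> cancel exactly one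
  step of it.\<close>

definition bcoeff :: "nat \<Rightarrow> real \<Rightarrow> real \<Rightarrow> nat \<Rightarrow> real" where
  "bcoeff n p q i = p ^ i * q ^ (n - i) /
     (fact i * fact (n - i) * pochhammer (\<alpha> + 1) i * pochhammer (\<beta> + 1) (n - i))"

text \<open>Two specializations matter: \<open>bsum s y (1 - y)\<close> is the homogeneous part of degree \<open>s\<close> of Appell's
  series \<open>F\<^sub>4\<close> in \<open>x y\<close> and \<open>(1 - x) (1 - y)\<close>, and \<open>bsum n (-1) 1\<close> is a multiple of the Jacobi polynomial.
  They are treated uniformly because \<open>jacobi_op\<close> lowers the degree with the factor \<open>p + q\<close>.\<close>

definition bsum :: "nat \<Rightarrow> real \<Rightarrow> real \<Rightarrow> real poly" where
  "bsum n p q = (\<Sum>i\<le>n. smult (bcoeff n p q i) (bernstein i (n - i)))"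

lemma poch_pos [simp]: "pochhammer (\<alpha> + 1) n > 0" "pochhammer (\<beta> + 1) n > 0"
  using \<alpha> \<beta> by (auto intro!: pochhammer_pos)

lemma poch_nz [simp]: "pochhammer (\<alpha> + 1) n \<noteq> 0" "pochhammer (\<beta> + 1) n \<noteq> 0"
  using poch_pos[of n] by linarith+

lemma poly_bsum: "poly (bsum n p q) x = (\<Sum>i\<le>n. bcoeff n p q i * (x ^ i * (1 - x) ^ (n - i)))"
  by (simp add: bsum_def poly_sum)

lemma degree_bsum: "degree (bsum n p q) \<le> n"
  unfolding bsum_def by (rule degree_sum_le) (auto intro: order_trans[OF degree_smult_le] simp: degree_bernstein)

text \<open>Lowering the first exponent reproduces the sum of degree \<open>n\<close> with weight
  \<open>p\<close>, lowering the second does so with weight \<open>q\<close>. The total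
  \<open>p + q\<close> is 0 for the Jacobi polynomial, which is therefore an eigenpolynomial, and 1
  for the parts of Appell's series.\<close>

lemma jacobi_op_bsum_Suc: "jacobi_op (bsum (Suc n) p q) = smult (- jacobi_eig (Suc n)) (bsum (Suc n) p q) + smult (p + q) (bsum n p q)"
proof -
  have 1: "bcoeff (Suc n) p q (Suc i) * (real (Suc i) * (real (Suc i) + \<alpha>)) = p * bcoeff n p q i" for i
  proof -
    have "real (Suc i) + \<alpha> > 0"
      using \<alpha> by simp
    then show ?thesis
      by (simp add: bcoeff_def pochhammer_Suc divide_simps del: of_nat_Suc)
  qed
  have 2: "bcoeff (Suc n) p q i * (real (Suc n - i) * (real (Suc n - i) + \<beta>)) = q * bcoeff n p q i"
    if "i \<le> n" for i
  proof -
    define j where "j = n - i"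
    then have n: "n = i + j"
      using that by simp
    have "real (Suc j) + \<beta> > 0"
      using \<beta> by simp
    then show ?thesis
      by (simp add: bcoeff_def pochhammer_Suc divide_simps n Suc_diff_le del: of_nat_Suc)
  qed
  have "jacobi_op (bsum (Suc n) p q) = (\<Sum>i\<le>Suc n. smult (bcoeff (Suc n) p q i) (smult (- jacobi_eig (Suc n)) (bernstein i (Suc n - i))
     + smult (real i * (real i + \<alpha>)) (bernstein (i - 1) (Suc n - i))
     + smult (real (Suc n - i) * (real (Suc n - i) + \<beta>)) (bernstein i (Suc n - i - 1))))"
    unfolding bsum_def jacobi_op_sum
    by (rule sum.cong[OF refl]) (auto simp: jacobi_op_smult jacobi_op_bernstein)
  also have "\<dots> = smult (- jacobi_eig (Suc n)) (bsum (Suc n) p q)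
     + (\<Sum>i\<le>Suc n. smult (bcoeff (Suc n) p q i * (real i * (real i + \<alpha>))) (bernstein (i - 1) (Suc n - i)))
     + (\<Sum>i\<le>Suc n. smult (bcoeff (Suc n) p q i * (real (Suc n - i) * (real (Suc n - i) + \<beta>))) (bernstein i (Suc n - i - 1)))"
    unfolding bsum_def by (simp only: smult_add_right sum.distrib smult_sum_right smult_smult mult.commute)
  also have "(\<Sum>i\<le>Suc n. smult (bcoeff (Suc n) p q i * (real i * (real i + \<alpha>))) (bernstein (i - 1) (Suc n - i)))
      = smult p (bsum n p q)"
    by (subst sum.atMost_Suc_shift) (simp add: 1 bsum_def smult_sum_right del: of_nat_Suc)
  also have "(\<Sum>i\<le>Suc n. smult (bcoeff (Suc n) p q i * (real (Suc n - i) * (real (Suc n - i) + \<beta>))) (bernstein i (Suc n - i - 1)))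
      = smult q (bsum n p q)"
    unfolding sum.atMost_Suc bsum_def smult_sum_right by (simp add: 2[symmetric] del: of_nat_Suc)
  finally show ?thesis
    by (simp add: smult_add_left)
qed

lemma jacobi_op_bsum_0: "jacobi_op (bsum 0 p q) = 0"
  by (simp add: bsum_def bernstein_def jacobi_op_def pderiv_smult)

definition jacobi_pol :: "nat \<Rightarrow> real poly" where
  "jacobi_pol n = bsum n (-1) 1"

lemma jacobi_op_jacobi_pol: "jacobi_op (jacobi_pol n) = smult (- jacobi_eig n) (jacobi_pol n)"
  by (cases n) (auto simp: jacobi_pol_def jacobi_op_bsum_Suc jacobi_op_bsum_0 jacobi_eig_def)

text \<open>The leading coefficients of the Bernstein products are alternating signs, and these turn
  the weights into the ones of the Jacobi polynomial. This is how the second variable enters the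
  expansion in products.\<close>

lemma coeff_bsum_top: "coeff (bsum n x (1 - x)) n = (-1) ^ n * poly (jacobi_pol n) x"
proof -
  have "coeff (bsum n x (1 - x)) n = (\<Sum>i\<le>n. bcoeff n x (1 - x) i * (-1) ^ (n - i))"
    unfolding bsum_def coeff_sum
  proof (rule sum.cong[OF refl])
    fix i assume "i \<in> {..n}"
    then show "coeff (smult (bcoeff n x (1 - x) i) (bernstein i (n - i))) n = bcoeff n x (1 - x) i * (-1) ^ (n - i)"
      using coeff_bernstein_top[of i "n - i"] by simp
  qed
  also have "\<dots> = (\<Sum>i\<le>n. (-1) ^ n * (bcoeff n (-1) 1 i * (x ^ i * (1 - x) ^ (n - i))))"
  proof (rule sum.cong[OF refl])
    fix i assume "i \<in> {..n}"
    then have "(-1) ^ (n - i) = (-1) ^ n * (-1 :: real) ^ i"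
      by (auto simp: power_add dest!: le_Suc_ex)
    then show "bcoeff n x (1 - x) i * (-1) ^ (n - i) = (-1) ^ n * (bcoeff n (-1) 1 i * (x ^ i * (1 - x) ^ (n - i)))"
      by (simp add: bcoeff_def)
  qed
  finally show ?thesis
    by (simp add: jacobi_pol_def poly_bsum sum_distrib_left)
qed

lemma poly_jacobi_pol_0: "poly (jacobi_pol n) 0 \<noteq> 0"
proof -
  have "poly (jacobi_pol n) 0 = bcoeff n (-1) 1 0"
    unfolding jacobi_pol_def poly_bsum by (subst sum.remove[of _ 0]) (auto simp: power_0_left)
  then show ?thesis
    by (simp add: bcoeff_def)
qed

text \<open>Otherwise uniqueness would make the eigenpolynomial zero, although its value at 0 is
  not. The leading coefficient never has to be evaluated.\<close>

lemma coeff_jacobi_pol_top: "coeff (jacobi_pol n) n \<noteq> 0"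
proof
  assume "coeff (jacobi_pol n) n = 0"
  then have "jacobi_pol n = 0"
    using eigenpoly_unique[OF jacobi_op_jacobi_pol] degree_bsum[of n "-1" 1] by (simp add: jacobi_pol_def)
  then show False
    using poly_jacobi_pol_0[of n] by simp
qed

lemma jacobi_poly_eq:
  "jacobi_poly \<alpha> \<beta> n (1 - 2 * x) = pochhammer (\<alpha> + 1) n * pochhammer (\<beta> + 1) n * poly (jacobi_pol n) x"
proof -
  \<comment> \<open>Used for \<alpha> with \<open>s\<close> and for \<beta> with
    \<open>n - s\<close>; \<open>c > -1\<close> keeps the Pochhammer symbol in the denominator
    positive.\<close>
  have g: "(real n + c) gchoose (n - s) = pochhammer (c + 1) n / (fact (n - s) * pochhammer (c + 1) s)"
    if "s \<le> n" "c > -1" for s c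
  proof -
    have p: "pochhammer (c + 1) s > 0"
      using that by (intro pochhammer_pos) auto
    have "pochhammer (c + 1) n = pochhammer (c + 1) s * pochhammer (c + 1 + real s) (n - s)"
      using that by (simp add: pochhammer_product)
    moreover have "(real n + c) gchoose (n - s) = pochhammer (c + 1 + real s) (n - s) / fact (n - s)"
      using that by (simp add: gbinomial_pochhammer' of_nat_diff algebra_simps)
    ultimately show ?thesis
      using p by simp
  qed
  have "jacobi_poly \<alpha> \<beta> n (1 - 2 * x) = (\<Sum>s\<le>n. pochhammer (\<alpha> + 1) n * pochhammer (\<beta> + 1) n *
      (bcoeff n (-1) 1 s * (x ^ s * (1 - x) ^ (n - s))))"
    unfolding jacobi_poly_def
  proof (rule sum.cong[OF refl])
    fix s assume s: "s \<in> {..n}"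
    have "(1 - 2 * x - 1) / 2 = - 1 * x" "(1 - 2 * x + 1) / 2 = 1 - x"
      by (simp_all add: field_simps)
    then have "((1 - 2 * x - 1) / 2) ^ s = (-1) ^ s * x ^ s" "((1 - 2 * x + 1) / 2) ^ (n - s) = (1 - x) ^ (n - s)"
      by (simp_all only: power_mult_distrib)
    moreover have "(real n + \<beta>) gchoose s = pochhammer (\<beta> + 1) n / (fact s * pochhammer (\<beta> + 1) (n - s))"
      using g[of "n - s" \<beta>] s \<beta> by simp
    moreover have "(real n + \<alpha>) gchoose (n - s) = pochhammer (\<alpha> + 1) n / (fact (n - s) * pochhammer (\<alpha> + 1) s)"
      using g[of s \<alpha>] s \<alpha> by simp
    ultimately show "((real n + \<alpha>) gchoose (n - s)) * ((real n + \<beta>) gchoose s) * ((1 - 2 * x - 1) / 2) ^ s *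
        ((1 - 2 * x + 1) / 2) ^ (n - s) = pochhammer (\<alpha> + 1) n * pochhammer (\<beta> + 1) n *
      (bcoeff n (-1) 1 s * (x ^ s * (1 - x) ^ (n - s)))"
      by (simp only: bcoeff_def divide_divide_eq_left times_divide_eq_right times_divide_eq_left mult_ac power_one mult_1_left mult_1_right)
  qed
  then show ?thesis
    by (simp add: jacobi_pol_def poly_bsum sum_distrib_left)
qed

end

section \<open>A generating function of binomial coefficients\<close>

definition shifted_central_binomial :: "real \<Rightarrow> nat \<Rightarrow> real" where
  "shifted_central_binomial \<mu> m = (2 * real m + \<mu>) gchoose m"

lemma shifted_central_binomial_pos: "\<mu> > -1 \<Longrightarrow> shifted_central_binomial \<mu> m > 0"
  by (auto simp: shifted_central_binomial_def gbinomial_pochhammer' intro!: divide_pos_pos pochhammer_pos)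

text \<open>This and the next relation link the coefficients for \<open>\<mu>\<close> and
  \<open>\<mu> + 1\<close>. Together they yield the convergence radius and a differential
  system.\<close>

lemma shifted_central_binomial_Suc: "real (Suc m) * shifted_central_binomial \<mu> (Suc m) = (2 * real m + 2 + \<mu>) * shifted_central_binomial (\<mu> + 1) m"
  using gbinomial_absorption[of m "2 * real m + 2 + \<mu>"] by (simp add: shifted_central_binomial_def algebra_simps)

lemma shifted_central_binomial_shift: "(real m + \<mu> + 1) * shifted_central_binomial (\<mu> + 1) m = (2 * real m + \<mu> + 1) * shifted_central_binomial \<mu> m"
  using gbinomial_absorb_comp[of "2 * real m + \<mu> + 1" m] by (simp add: shifted_central_binomial_def algebra_simps)

lemma conv_radius_shifted_central_binomial:
  assumes "\<mu> > -1"
  shows "conv_radius (shifted_central_binomial \<mu>) = ereal (1 / 4)"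
proof (rule conv_radius_ratio_limit[OF refl])
  have "(real m + \<mu> + 1) * (real m + 1) / ((2 * real m + 2 + \<mu>) * (2 * real m + \<mu> + 1)) =
        norm (shifted_central_binomial \<mu> m) / norm (shifted_central_binomial \<mu> (Suc m))" for m
  proof -
    have p: "shifted_central_binomial \<mu> m > 0" "shifted_central_binomial \<mu> (Suc m) > 0" "shifted_central_binomial (\<mu> + 1) m > 0" "2 * real m + 2 + \<mu> > 0" "2 * real m + \<mu> + 1 > 0"
      using assms by (auto intro!: shifted_central_binomial_pos)
    \<comment> \<open>Eliminating the coefficient for \<open>\<mu> + 1\<close> leaves a two-term
      recurrence in \<open>m\<close>.\<close>
    have "(real m + \<mu> + 1) * ((real m + 1) * shifted_central_binomial \<mu> (Suc m)) = (2 * real m + 2 + \<mu>) * ((2 * real m + \<mu> + 1) * shifted_central_binomial \<mu> m)"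
      using shifted_central_binomial_Suc[of m \<mu>] shifted_central_binomial_shift[of m \<mu>] by (simp add: algebra_simps)
    then show ?thesis
      using p by (simp add: divide_simps) (simp add: algebra_simps)
  qed
  moreover have "(\<lambda>m. (real m + \<mu> + 1) * (real m + 1) / ((2 * real m + 2 + \<mu>) * (2 * real m + \<mu> + 1))) \<longlonglongrightarrow> 1 / 4"
    by real_asymp
  ultimately show "(\<lambda>m. norm (shifted_central_binomial \<mu> m) / norm (shifted_central_binomial \<mu> (Suc m))) \<longlonglongrightarrow> 1 / 4"
    by simp
  show "eventually (\<lambda>m. shifted_central_binomial \<mu> m \<noteq> 0) sequentially"
    using shifted_central_binomial_pos[OF assms] by (auto intro!: always_eventually simp: less_imp_neq[symmetric])
qed

lemma summable_shifted_central_binomial: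
  assumes "\<mu> > -1" "\<bar>x\<bar> < 1 / 4"
  shows "summable (\<lambda>m. shifted_central_binomial \<mu> m * x ^ m)"
  using assms by (intro summable_in_conv_radius) (simp add: conv_radius_shifted_central_binomial)

definition binomial_gf :: "real \<Rightarrow> real \<Rightarrow> real" where
  "binomial_gf \<mu> x = (\<Sum>m. shifted_central_binomial \<mu> m * x ^ m)"

definition binomial_gf' :: "real \<Rightarrow> real \<Rightarrow> real" where
  "binomial_gf' \<mu> x = (\<Sum>m. diffs (shifted_central_binomial \<mu>) m * x ^ m)"

lemma binomial_gf_0 [simp]: "binomial_gf \<mu> 0 = 1"
  by (simp add: binomial_gf_def powser_zero shifted_central_binomial_def)

lemma binomial_gf_has_derivative:
  assumes "\<mu> > -1" "\<bar>x\<bar> < 1 / 4"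
  shows "(binomial_gf \<mu> has_real_derivative binomial_gf' \<mu> x) (at x)"
proof -
  obtain K where K: "\<bar>x\<bar> < K" "K < 1 / 4"
    using assms dense by blast
  show ?thesis
    unfolding binomial_gf_def[abs_def] binomial_gf'_def
    by (rule termdiffs_strong[of _ K]) (use K assms in \<open>auto intro!: summable_shifted_central_binomial\<close>)
qed

lemma binomial_gf_ode_sums:
  assumes "\<mu> > -1" "\<bar>x\<bar> < 1 / 4"
  shows "(\<lambda>m. real m * shifted_central_binomial \<mu> m * x ^ m) sums (x * binomial_gf' \<mu> x)"
proof -
  obtain K where K: "\<bar>x\<bar> < K" "K < 1 / 4"
    using assms dense by blast
  have "summable (\<lambda>m. diffs (shifted_central_binomial \<mu>) m * x ^ m)"
  proof (rule termdiff_converges[of _ K])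
    show "summable (\<lambda>m. shifted_central_binomial \<mu> m * z ^ m)" if "norm z < K" for z
      using that K assms by (intro summable_shifted_central_binomial) auto
  qed (use K in auto)
  from sums_mult[OF diffs_equiv[OF this], of x] show ?thesis
    unfolding binomial_gf'_def
    by (rule sums_cong[THEN iffD1, rotated]) (auto simp: power_eq_if mult_ac)
qed

text \<open>The two contiguity relations multiplied by \<open>x^m\<close> and summed: a factor
  \<open>m\<close> becomes the operator \<open>x d/dx\<close>.\<close>

lemma binomial_gf_system:
  assumes "\<mu> > -1" "\<bar>x\<bar> < 1 / 4"
  shows "binomial_gf' \<mu> x = 2 * x * binomial_gf' (\<mu> + 1) x + (\<mu> + 2) * binomial_gf (\<mu> + 1) x"
    and "x * binomial_gf' (\<mu> + 1) x + (\<mu> + 1) * binomial_gf (\<mu> + 1) x = 2 * x * binomial_gf' \<mu> x + (\<mu> + 1) * binomial_gf \<mu> x"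
proof -
  have f: "(\<lambda>m. shifted_central_binomial \<mu> m * x ^ m) sums binomial_gf \<mu> x"
    and g: "(\<lambda>m. shifted_central_binomial (\<mu> + 1) m * x ^ m) sums binomial_gf (\<mu> + 1) x"
    unfolding binomial_gf_def using assms by (auto intro!: summable_sums summable_shifted_central_binomial)
  note f' = binomial_gf_ode_sums[OF assms]
  have g': "(\<lambda>m. real m * shifted_central_binomial (\<mu> + 1) m * x ^ m) sums (x * binomial_gf' (\<mu> + 1) x)"
    using assms by (intro binomial_gf_ode_sums) auto
  have "(\<lambda>m. 2 * (real m * shifted_central_binomial (\<mu> + 1) m * x ^ m) + (\<mu> + 2) * (shifted_central_binomial (\<mu> + 1) m * x ^ m)) sums
      (2 * (x * binomial_gf' (\<mu> + 1) x) + (\<mu> + 2) * binomial_gf (\<mu> + 1) x)"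
    by (intro sums_add sums_mult f g g')
  moreover have "2 * (real m * shifted_central_binomial (\<mu> + 1) m * x ^ m) + (\<mu> + 2) * (shifted_central_binomial (\<mu> + 1) m * x ^ m) = diffs (shifted_central_binomial \<mu>) m * x ^ m" for m
    unfolding diffs_def of_nat_Suc[symmetric] shifted_central_binomial_Suc by (simp add: algebra_simps)
  ultimately show "binomial_gf' \<mu> x = 2 * x * binomial_gf' (\<mu> + 1) x + (\<mu> + 2) * binomial_gf (\<mu> + 1) x"
    by (simp add: binomial_gf'_def sums_iff mult.assoc)
  have "(\<lambda>m. real m * shifted_central_binomial (\<mu> + 1) m * x ^ m + (\<mu> + 1) * (shifted_central_binomial (\<mu> + 1) m * x ^ m)) sums
      (x * binomial_gf' (\<mu> + 1) x + (\<mu> + 1) * binomial_gf (\<mu> + 1) x)"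
    by (intro sums_add sums_mult g g')
  moreover have "(\<lambda>m. 2 * (real m * shifted_central_binomial \<mu> m * x ^ m) + (\<mu> + 1) * (shifted_central_binomial \<mu> m * x ^ m)) sums
      (2 * (x * binomial_gf' \<mu> x) + (\<mu> + 1) * binomial_gf \<mu> x)"
    by (intro sums_add sums_mult f f')
  moreover have "real m * shifted_central_binomial (\<mu> + 1) m * x ^ m + (\<mu> + 1) * (shifted_central_binomial (\<mu> + 1) m * x ^ m) =
     2 * (real m * shifted_central_binomial \<mu> m * x ^ m) + (\<mu> + 1) * (shifted_central_binomial \<mu> m * x ^ m)" for m
  proof -
    have "real m * shifted_central_binomial (\<mu> + 1) m * x ^ m + (\<mu> + 1) * (shifted_central_binomial (\<mu> + 1) m * x ^ m) = ((real m + \<mu> + 1) * shifted_central_binomial (\<mu> + 1) m) * x ^ m"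
      by (simp add: algebra_simps)
    also have "\<dots> = ((2 * real m + \<mu> + 1) * shifted_central_binomial \<mu> m) * x ^ m"
      by (simp only: shifted_central_binomial_shift)
    finally show ?thesis
      by (simp add: algebra_simps)
  qed
  ultimately show "x * binomial_gf' (\<mu> + 1) x + (\<mu> + 1) * binomial_gf (\<mu> + 1) x = 2 * x * binomial_gf' \<mu> x + (\<mu> + 1) * binomial_gf \<mu> x"
    using sums_unique2 by (simp add: mult.assoc)
qed

text \<open>Logarithmic form: the power stays as a factor, so that in a product of powers the
  logarithmic derivatives simply add.\<close>

lemma has_real_derivative_powr_log:
  fixes g :: "real \<Rightarrow> real"
  assumes "(g has_real_derivative m) (at x)" "g x > 0"
  shows "((\<lambda>x. g x powr a) has_real_derivative g x powr a * (a * m / g x)) (at x)"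
  using DERIV_fun_powr[OF assms, of a] assms(2) by (simp add: powr_diff mult_ac)

text \<open>With \<open>F\<close> and \<open>G\<close> the series for \<open>\<mu>\<close> and \<open>\<mu> + 1\<close>, contiguity gives a first order system. The
  combination \<open>G - (1 + r) F\<close> solves a homogeneous linear equation whose nonzero solutions behave like
  \<open>r powr - (\<mu> + 1)\<close> near \<open>0\<close>, so it vanishes; the system then reduces to one equation for \<open>F\<close>.\<close>

lemma binomial_gf_eq:
  assumes \<mu>: "\<mu> > -1" and R: "0 < R" "R < 1"
  shows "binomial_gf \<mu> (R / (1 + R)\<^sup>2) = (1 + R) powr (\<mu> + 1) / (1 - R)"
proof -
  \<comment> \<open>\<open>X1\<close> is the derivative of \<open>X\<close>. The interval [0,1) is
    mapped into [0,1/4), inside the disk of convergence.\<close>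
  define X X1 where "X r = r / (1 + r)\<^sup>2" and "X1 r = (1 - r) / (1 + r) ^ 3" for r :: real
  define F G where "F r = binomial_gf \<mu> (X r)" and "G r = binomial_gf (\<mu> + 1) (X r)" for r
  define p q where "p r = binomial_gf' \<mu> (X r)" and "q r = binomial_gf' (\<mu> + 1) (X r)" for r
  have X_bound: "\<bar>X r\<bar> < 1 / 4" if "0 \<le> r" "r < 1" for r
  proof -
    have "(1 - r) ^ 2 > 0"
      using that by simp
    then have "4 * r < (1 + r) ^ 2"
      by (simp add: power2_eq_square algebra_simps)
    then show ?thesis
      using that by (simp add: X_def abs_if field_simps)
  qed
  have dX: "(X has_real_derivative X1 r) (at r)" if "0 \<le> r" for r
    unfolding X_def X1_def using that
    by (auto intro!: derivative_eq_intros simp: divide_simps) (simp add: power2_eq_square power3_eq_cube power4_eq_xxxx algebra_simps)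
  have dF: "(F has_real_derivative p r * X1 r) (at r)" if "0 \<le> r" "r < 1" for r
    unfolding F_def p_def
    by (rule DERIV_chain2[OF binomial_gf_has_derivative dX]) (use that X_bound \<mu> in auto)
  have dG: "(G has_real_derivative q r * X1 r) (at r)" if "0 \<le> r" "r < 1" for r
    unfolding G_def q_def
    by (rule DERIV_chain2[OF binomial_gf_has_derivative dX]) (use that X_bound \<mu> in auto)
  have contF: "continuous_on {0..r} F" and contG: "continuous_on {0..r} G" if "r < 1" for r
    using that by (auto intro!: continuous_at_imp_continuous_on DERIV_isCont[OF dF] DERIV_isCont[OF dG])
  have p: "p r = 2 * X r * q r + (\<mu> + 2) * G r" 
    and q: "q r = (2 * (\<mu> + 2) * r * (1 + r)\<^sup>2 * G r + (\<mu> + 1) * (1 + r) ^ 4 * (F r - G r)) / (r * (1 - r)\<^sup>2)"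
    if r: "0 < r" "r < 1" for r
  proof -
    show 1: "p r = 2 * X r * q r + (\<mu> + 2) * G r"
      unfolding p_def q_def G_def by (rule binomial_gf_system) (use \<mu> X_bound r in auto)
    have 2: "X r * q r + (\<mu> + 1) * G r = 2 * X r * p r + (\<mu> + 1) * F r"
      unfolding p_def q_def G_def F_def by (rule binomial_gf_system) (use \<mu> X_bound r in auto)
    \<comment> \<open>Eliminating \<open>p\<close> brings in \<open>1 - 4 X\<close>. The
      substitution makes it the square of \<open>(1 - r) / (1 + r)\<close>, so the system has
      rational coefficients in \<open>r\<close>.\<close>
    have "X r * (1 - 4 * X r) * q r = 2 * (\<mu> + 2) * X r * G r + (\<mu> + 1) * (F r - G r)"
      using 2 unfolding 1 by (simp add: algebra_simps)
    moreover have "1 - 4 * X r = (1 - r)\<^sup>2 / (1 + r)\<^sup>2"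
      using r by (simp add: X_def divide_simps) (simp add: power2_eq_square algebra_simps)
    ultimately have *: "r / (1 + r)\<^sup>2 * ((1 - r)\<^sup>2 / (1 + r)\<^sup>2) * q r = 2 * (\<mu> + 2) * (r / (1 + r)\<^sup>2) * G r + (\<mu> + 1) * (F r - G r)"
      by (simp add: X_def)
    have s: "1 + r \<noteq> 0"
      using r by simp
    have "r * (1 - r)\<^sup>2 * q r = (1 + r) ^ 4 * (r / (1 + r)\<^sup>2 * ((1 - r)\<^sup>2 / (1 + r)\<^sup>2) * q r)"
      using s by (simp add: field_simps flip: power_add)
    also have "\<dots> = 2 * (\<mu> + 2) * r * (1 + r)\<^sup>2 * G r + (\<mu> + 1) * (1 + r) ^ 4 * (F r - G r)"
    proof -
      have "S ^ 4 * (2 * (\<mu> + 2) * (r / S\<^sup>2) * g + (\<mu> + 1) * h) = 2 * (\<mu> + 2) * r * S\<^sup>2 * g + (\<mu> + 1) * S ^ 4 * h"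
        if "S \<noteq> 0" for S g h
        using that by (simp add: field_simps power2_eq_square power4_eq_xxxx)
      from this[OF s] show ?thesis
        unfolding * .
    qed
    finally show "q r = (2 * (\<mu> + 2) * r * (1 + r)\<^sup>2 * G r + (\<mu> + 1) * (1 + r) ^ 4 * (F r - G r)) / (r * (1 - r)\<^sup>2)"
      using r by (simp add: divide_simps mult_ac)
  qed
  have GF: "G r = (1 + r) * F r" if r: "0 < r" "r < 1" for r
  proof -
    \<comment> \<open>\<open>W\<close> is \<open>D\<close> times its integrating factor. Since
      \<open>\<mu> + 1 > 0\<close>, \<open>W\<close> is continuous at 0 with value 0 there.\<close>
    define D W where "D s = G s - (1 + s) * F s" and "W s = D s * (s powr (\<mu> + 1) * (1 + s) powr (- (\<mu> + 2)))" for s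
    have "W r = W 0"
    proof (rule DERIV_isconst_end[OF r(1)])
      show "continuous_on {0..r} W"
        unfolding W_def D_def using r \<mu>
        by (intro continuous_intros contF contG continuous_on_powr') auto
      show "(W has_real_derivative 0) (at s)" if s: "0 < s" "s < r" for s
      proof -
        have s1: "s < 1" "s \<noteq> 1"
          using s r by auto
        have "q s * X1 s - F s - (1 + s) * (p s * X1 s) + D s * ((\<mu> + 1) / s - (\<mu> + 2) / (1 + s)) = 0"
          unfolding p[OF s(1) s1(1)] q[OF s(1) s1(1)] X_def X1_def D_def
          using s s1 by (simp add: divide_simps) algebra
        then have *: "q s * X1 s - F s - (1 + s) * (p s * X1 s) = - D s * ((\<mu> + 1) / s - (\<mu> + 2) / (1 + s))"
          by simp
        have 1: "((\<lambda>s. s powr (\<mu> + 1) * (1 + s) powr (- (\<mu> + 2))) has_real_derivative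
             s powr (\<mu> + 1) * (1 + s) powr (- (\<mu> + 2)) * ((\<mu> + 1) / s - (\<mu> + 2) / (1 + s))) (at s)"
          by (rule DERIV_cong[OF DERIV_mult[OF has_real_derivative_powr_log has_real_derivative_powr_log]])
             (use s in \<open>auto intro!: derivative_eq_intros simp: field_simps\<close>)
        have 2: "(D has_real_derivative q s * X1 s - F s - (1 + s) * (p s * X1 s)) (at s)"
          unfolding D_def[abs_def] using s s1 by (auto intro!: derivative_eq_intros dF dG)
        show ?thesis
          unfolding W_def
          by (rule DERIV_cong[OF DERIV_mult[OF 2[unfolded *] 1]]) (simp add: mult_ac)
      qed
    qed
    then show ?thesis
      using r by (simp add: W_def D_def F_def G_def X_def)
  qed
  \<comment> \<open>Once \<open>G = (1 + r) F\<close>, the logarithmic derivative of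
    \<open>F\<close> is \<open>(\<mu> + 1) / (1 + s) + 1 / (1 - s)\<close>; \<open>V\<close> divides
    \<open>F\<close> by the corresponding solution, and \<open>V 0 = 1\<close>.\<close>
  define V where "V s = F s * ((1 - s) * (1 + s) powr (- (\<mu> + 1)))" for s
  have "V R = V 0"
  proof (rule DERIV_isconst_end[OF R(1)])
    show "continuous_on {0..R} V"
      unfolding V_def using R
      by (intro continuous_intros contF) auto
    show "(V has_real_derivative 0) (at s)" if s: "0 < s" "s < R" for s
    proof -
      have s1: "s < 1" "s \<noteq> 1"
        using s R by auto
      have *: "p s * X1 s = F s * ((\<mu> + 1) / (1 + s) + 1 / (1 - s))"
        unfolding p[OF s(1) s1(1)] q[OF s(1) s1(1)] X_def X1_def GF[OF s(1) s1(1)]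
        using s s1 by (simp add: divide_simps) algebra
      have 1: "((\<lambda>s. (1 - s) * (1 + s) powr (- (\<mu> + 1))) has_real_derivative
             - ((1 - s) * (1 + s) powr (- (\<mu> + 1)) * ((\<mu> + 1) / (1 + s) + 1 / (1 - s)))) (at s)"
      proof -
        have a: "((\<lambda>s. 1 - s) has_real_derivative -1) (at s)" "((\<lambda>s. 1 + s) has_real_derivative 1) (at s)"
          by (auto intro!: derivative_eq_intros)
        show ?thesis
          by (rule DERIV_cong[OF DERIV_mult[OF a(1) has_real_derivative_powr_log[OF a(2)]]])
             (use s s1 in \<open>simp_all add: divide_simps\<close>, simp add: algebra_simps)
      qed
      show ?thesis
        unfolding V_def using s s1
        by (intro DERIV_cong[OF DERIV_mult[OF dF[of s, unfolded *] 1]]) (auto simp: mult_ac)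
    qed
  qed
  then show ?thesis
    using R unfolding V_def F_def X_def powr_minus_divide by (simp add: field_simps)
qed

lemma Gamma_add_nat:
  assumes "c > (0::real)"
  shows "Gamma (c + real n) = pochhammer c n * Gamma c"
proof -
  have "Gamma c > 0" "c \<notin> \<int>\<^sub>\<le>\<^sub>0"
    using assms by (auto elim!: nonpos_Ints_cases)
  then show ?thesis
    by (simp add: pochhammer_Gamma)
qed

section \<open>Moments of the Jacobi weight and norms of the Jacobi polynomials\<close>

context jacobi
begin

abbreviation \<kappa> :: real where "\<kappa> \<equiv> \<alpha> + \<beta> + 2"

lemma Gamma_pos [simp]: "Gamma (\<alpha> + 1) > 0" "Gamma (\<beta> + 1) > 0" "Gamma (\<kappa> + real m) > 0"
  using \<alpha> \<beta> by (auto intro!: Gamma_real_pos)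

text \<open>The substitution \<open>t = sin^2 (\<theta>/2)\<close> has
  \<open>dt = sin (\<theta>/2) cos (\<theta>/2) d\<theta>\<close>, which takes one power of each
  function from the weight and leaves a Beta integral.\<close>

lemma jacobi_moment:
  "has_bochner_integral (jacobi_measure \<alpha> \<beta>)
     (\<lambda>\<theta>. ((1 - cos \<theta>) / 2) ^ i * (1 - (1 - cos \<theta>) / 2) ^ j) (Beta (\<alpha> + 1 + real i) (\<beta> + 1 + real j))"
proof -
  define f where "f t = t powr (\<alpha> + real i) * (1 - t) powr (\<beta> + real j)" for t
  define g where "g \<theta> = (sin (\<theta> / 2))\<^sup>2" for \<theta> :: real
  define g' where "g' \<theta> = sin (\<theta> / 2) * cos (\<theta> / 2)" for \<theta> :: real
  define w where "w \<theta> = indicator {0..pi} \<theta> * (sin (\<theta> / 2) powr (2 * \<alpha> + 1) * cos (\<theta> / 2) powr (2 * \<beta> + 1))" for \<theta>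
  have pos: "\<alpha> + 1 + real i > 0" "\<beta> + 1 + real j > 0"
    using \<alpha> \<beta> by auto
  have g01: "g 0 = 0" "g pi = 1"
    by (auto simp: g_def)
  have f: "set_integrable lborel {g 0..g pi} f"
    using integrable_Beta[OF pos] by (simp add: f_def[abs_def] g01)
  have nn: "sin (x / 2) \<ge> 0" "cos (x / 2) \<ge> 0" if "x \<in> {0..pi}" for x
    using that by (auto intro!: sin_ge_zero cos_ge_zero)
  have "(g has_real_derivative g' x) (at x)" for x
    unfolding g_def g'_def by (auto intro!: derivative_eq_intros)
  moreover have "continuous_on {0..pi} g'"
    unfolding g'_def by (intro continuous_intros) auto
  moreover have "g' x \<ge> 0" if "x \<in> {0..pi}" for x
    unfolding g'_def using nn[OF that] by simp
  ultimately have 1: "set_integrable lborel {0..pi} (\<lambda>x. f (g x) * g' x)"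
    "(LBINT x. f x * indicator {0..1} x) = (LBINT x. f (g x) * g' x * indicator {0..pi} x)"
    using integral_substitution[where g = g and a = 0 and b = pi and g' = g', OF f] by (simp_all add: g01)
  have "(LBINT x:{0..1}. f x) = integral {0..1} f"
    using f by (intro set_borel_integral_eq_integral) (simp add: g01)
  also have "\<dots> = Beta (\<alpha> + 1 + real i) (\<beta> + 1 + real j)"
    using has_integral_Beta_real[OF pos] by (intro integral_unique) (simp add: f_def[abs_def])
  finally have 2: "has_bochner_integral lborel (\<lambda>x. indicator {0..pi} x * (f (g x) * g' x)) (Beta (\<alpha> + 1 + real i) (\<beta> + 1 + real j))"
    using 1 by (simp add: has_bochner_integral_iff set_integrable_def set_lebesgue_integral_def mult_ac)
  have 3: "indicator {0..pi} x * (f (g x) * g' x) = w x *\<^sub>R (((1 - cos x) / 2) ^ i * (1 - (1 - cos x) / 2) ^ j)" for x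
  proof (cases "x \<in> {0..pi}")
    case True
    have c: "(1 - cos x) / 2 = (sin (x / 2))\<^sup>2" "1 - (sin (x / 2))\<^sup>2 = (cos (x / 2))\<^sup>2"
      using cos_double_sin[of "x / 2"] cos_squared_eq[of "x / 2"] by auto
    \<comment> \<open>At \<open>s = 0\<close> both sides vanish because \<open>0 powr a = 0\<close>
      for every exponent; the endpoints thus need no separate treatment.\<close>
    have S: "(s\<^sup>2) powr (a + real k) * s = s powr (2 * a + 1) * (s\<^sup>2) ^ k" if "s \<ge> 0" for s a k
    proof (cases "s = 0")
      case False
      with that have "s > 0" by simp
      have "(s\<^sup>2) powr b = s powr (2 * b)" for b
        using \<open>s > 0\<close> powr_powr[of s 2 b] by simp
      moreover have "(s\<^sup>2) ^ k = s powr (2 * real k)"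
        using powr_realpow[OF \<open>s > 0\<close>, of "2 * k"] by (simp add: power_mult)
      ultimately show ?thesis
        using \<open>s > 0\<close> by (simp add: powr_add distrib_left mult_ac)
    qed auto
    have "f (g x) * g' x = ((sin (x / 2))\<^sup>2 powr (\<alpha> + real i) * sin (x / 2)) * ((cos (x / 2))\<^sup>2 powr (\<beta> + real j) * cos (x / 2))"
      by (simp add: f_def g_def g'_def c)
    also have "\<dots> = (sin (x / 2) powr (2 * \<alpha> + 1) * ((sin (x / 2))\<^sup>2) ^ i) * (cos (x / 2) powr (2 * \<beta> + 1) * ((cos (x / 2))\<^sup>2) ^ j)"
      using nn[OF True] by (simp only: S)
    finally show ?thesis
      using True by (simp add: w_def c)
  qed (auto simp: w_def)
  have "jacobi_measure \<alpha> \<beta> = density lborel (\<lambda>x. ennreal (w x))"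
    unfolding jacobi_measure_def by (rule arg_cong[where f = "density lborel"]) (auto simp: w_def fun_eq_iff indicator_def)
  moreover have "has_bochner_integral (density lborel (\<lambda>x. ennreal (w x)))
     (\<lambda>\<theta>. ((1 - cos \<theta>) / 2) ^ i * (1 - (1 - cos \<theta>) / 2) ^ j) (Beta (\<alpha> + 1 + real i) (\<beta> + 1 + real j))"
  proof (rule has_bochner_integral_density)
    show "AE x in lborel. 0 \<le> w x"
      by (auto simp: w_def)
    show "w \<in> borel_measurable lborel"
      unfolding w_def by measurable
  qed (use 2 in \<open>simp_all add: 3\<close>)
  ultimately show ?thesis
    by simp
qed

definition jacobi_sqnorm :: "nat \<Rightarrow> real" where
  "jacobi_sqnorm n = (LINT \<theta>|jacobi_measure \<alpha> \<beta>. (poly (jacobi_pol n) ((1 - cos \<theta>) / 2))\<^sup>2)"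

text \<open>The Gamma factors of the Beta moments cancel the Pochhammer symbols of the coefficients.
  What remains is an \<open>n\<close>-th difference of a polynomial of degree \<open>k\<close> in
  the index.\<close>

lemma jacobi_pol_power_integral:
  assumes "k \<le> n"
  shows "has_bochner_integral (jacobi_measure \<alpha> \<beta>)
      (\<lambda>\<theta>. poly (jacobi_pol n) ((1 - cos \<theta>) / 2) * ((1 - cos \<theta>) / 2) ^ k)
      (if k < n then 0 else (-1) ^ n * (Gamma (\<alpha> + 1) * Gamma (\<beta> + 1) / Gamma (\<kappa> + 2 * real n)))"
proof -
  define C where "C = Gamma (\<alpha> + 1) * Gamma (\<beta> + 1) / (Gamma (\<kappa> + real n + real k) * fact n)"
  have "has_bochner_integral (jacobi_measure \<alpha> \<beta>)
      (\<lambda>\<theta>. \<Sum>i\<le>n. bcoeff n (-1) 1 i * (((1 - cos \<theta>) / 2) ^ (i + k) * (1 - (1 - cos \<theta>) / 2) ^ (n - i)))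
      (\<Sum>i\<le>n. bcoeff n (-1) 1 i * Beta (\<alpha> + 1 + real (i + k)) (\<beta> + 1 + real (n - i)))"
    by (intro has_bochner_integral_sum has_bochner_integral_mult_right jacobi_moment)
  also have "(\<lambda>\<theta>. \<Sum>i\<le>n. bcoeff n (-1) 1 i * (((1 - cos \<theta>) / 2) ^ (i + k) * (1 - (1 - cos \<theta>) / 2) ^ (n - i)))
      = (\<lambda>\<theta>. poly (jacobi_pol n) ((1 - cos \<theta>) / 2) * ((1 - cos \<theta>) / 2) ^ k)"
    unfolding jacobi_pol_def poly_bsum sum_distrib_right by (simp add: power_add mult_ac)
  also have "(\<Sum>i\<le>n. bcoeff n (-1) 1 i * Beta (\<alpha> + 1 + real (i + k)) (\<beta> + 1 + real (n - i)))
      = (\<Sum>i\<le>n. C * ((-1) ^ i * real (n choose i) * pochhammer (\<alpha> + 1 + real i) k))"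
  proof (rule sum.cong[OF refl])
    fix i assume i: "i \<in> {..n}"
    have "Gamma (\<alpha> + 1 + real (i + k)) = pochhammer (\<alpha> + 1) i * pochhammer (\<alpha> + 1 + real i) k * Gamma (\<alpha> + 1)"
      using \<alpha> by (subst Gamma_add_nat) (auto simp: pochhammer_product')
    moreover have "Gamma (\<beta> + 1 + real (n - i)) = pochhammer (\<beta> + 1) (n - i) * Gamma (\<beta> + 1)"
      using \<beta> by (subst Gamma_add_nat) auto
    moreover have "\<alpha> + 1 + real (i + k) + (\<beta> + 1 + real (n - i)) = \<kappa> + real n + real k"
      using i by simp
    moreover have "real (n choose i) = fact n / (fact i * fact (n - i))"
      using i by (simp add: binomial_fact)
    note facts = calculation this
    show "bcoeff n (-1) 1 i * Beta (\<alpha> + 1 + real (i + k)) (\<beta> + 1 + real (n - i)) =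
        C * ((-1) ^ i * real (n choose i) * pochhammer (\<alpha> + 1 + real i) k)"
      unfolding bcoeff_def Beta_def C_def facts by (simp add: mult_ac)
  qed
  also have "\<dots> = C * (if k < n then 0 else (-1) ^ n * fact n)"
    by (simp only: sum_distrib_left[symmetric] alternating_sum_pochhammer[OF assms])
  also have "\<dots> = (if k < n then 0 else (-1) ^ n * (Gamma (\<alpha> + 1) * Gamma (\<beta> + 1) / Gamma (\<kappa> + 2 * real n)))"
  proof (cases "k < n")
    case False
    then have kn: "k = n" and arg: "\<kappa> + real n + real k = \<kappa> + 2 * real n"
      using assms by auto
    show ?thesis
      unfolding C_def arg using kn by simp
  qed simp
  finally show ?thesis .
qed

text \<open>Expand one of the two factors in powers: all but the top power are orthogonal to the
  other factor. The leading coefficient is kept symbolic because it cancels later.\<close>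

lemma jacobi_sqnorm_eq:
  "jacobi_sqnorm n = coeff (jacobi_pol n) n * ((-1) ^ n * (Gamma (\<alpha> + 1) * Gamma (\<beta> + 1) / Gamma (\<kappa> + 2 * real n)))"
proof -
  let ?G = "(-1) ^ n * (Gamma (\<alpha> + 1) * Gamma (\<beta> + 1) / Gamma (\<kappa> + 2 * real n))"
  have "has_bochner_integral (jacobi_measure \<alpha> \<beta>)
      (\<lambda>\<theta>. \<Sum>k\<le>n. coeff (jacobi_pol n) k * (poly (jacobi_pol n) ((1 - cos \<theta>) / 2) * ((1 - cos \<theta>) / 2) ^ k))
      (\<Sum>k\<le>n. coeff (jacobi_pol n) k * (if k < n then 0 else ?G))"
    by (intro has_bochner_integral_sum has_bochner_integral_mult_right jacobi_pol_power_integral) auto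
  also have "(\<lambda>\<theta>. \<Sum>k\<le>n. coeff (jacobi_pol n) k * (poly (jacobi_pol n) ((1 - cos \<theta>) / 2) * ((1 - cos \<theta>) / 2) ^ k))
     = (\<lambda>\<theta>. (poly (jacobi_pol n) ((1 - cos \<theta>) / 2))\<^sup>2)"
  proof
    fix \<theta>
    have "poly (jacobi_pol n) x = (\<Sum>k\<le>n. coeff (jacobi_pol n) k * x ^ k)" for x
      unfolding poly_altdef using degree_bsum[of n "-1" 1]
      by (intro sum.mono_neutral_left) (auto simp: jacobi_pol_def coeff_eq_0)
    then show "(\<Sum>k\<le>n. coeff (jacobi_pol n) k * (poly (jacobi_pol n) ((1 - cos \<theta>) / 2) * ((1 - cos \<theta>) / 2) ^ k))
        = (poly (jacobi_pol n) ((1 - cos \<theta>) / 2))\<^sup>2"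
      by (simp add: power2_eq_square sum_distrib_left mult_ac)
  qed
  also have "(\<Sum>k\<le>n. coeff (jacobi_pol n) k * (if k < n then 0 else ?G)) = coeff (jacobi_pol n) n * ?G"
    by (subst sum.remove[of _ n]) (auto intro!: sum.neutral)
  finally show ?thesis
    by (simp add: jacobi_sqnorm_def has_bochner_integral_iff)
qed

lemma jacobi_sqnorm_pos: "jacobi_sqnorm n > 0"
proof -
  have "jacobi_sqnorm n \<ge> 0"
    unfolding jacobi_sqnorm_def by (rule integral_nonneg_AE) auto
  moreover have "Gamma (\<kappa> + 2 * real n) \<noteq> 0" "Gamma (\<alpha> + 1) \<noteq> 0" "Gamma (\<beta> + 1) \<noteq> 0"
    using Gamma_pos(3)[of "2 * n"] Gamma_pos(1,2) by (simp_all del: Gamma_pos)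
  then have "jacobi_sqnorm n \<noteq> 0"
    using coeff_jacobi_pol_top[of n] by (simp add: jacobi_sqnorm_eq)
  ultimately show ?thesis
    by simp
qed

section \<open>Expansion of the homogeneous parts in products of Jacobi polynomials\<close>

definition jacobi_product :: "real \<Rightarrow> real \<Rightarrow> nat \<Rightarrow> real" where
  "jacobi_product x y n = poly (jacobi_pol n) x * poly (jacobi_pol n) y / jacobi_sqnorm n"

text \<open>The solution, equal to 1 at \<open>s = n\<close>, of the recursion in the next lemma,
  which is the condition that the operator imposes on the expansion coefficients. The right-hand
  factor there is the step of \<open>Gamma (\<kappa> + 2 s)\<close>.\<close>

definition expansion_coeff :: "nat \<Rightarrow> nat \<Rightarrow> real" where
  "expansion_coeff s n = (2 * real s + \<kappa> - 1) gchoose (s - n)"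

lemma expansion_coeff_jacobi_eig:
  assumes "n \<le> s"
  shows "expansion_coeff (Suc s) n * (jacobi_eig (Suc s) - jacobi_eig n) = (2 * real s + \<kappa> + 1) * (2 * real s + \<kappa>) * expansion_coeff s n"
proof -
  define k N where "k = s - n" and "N = 2 * real s + \<kappa> + 1"
  have k: "Suc s - n = Suc k" "real s = real n + real k"
    using assms by (auto simp: k_def)
  have N: "2 * real (Suc s) + \<kappa> - 1 = N" "2 * real s + \<kappa> - 1 = N - 1 - 1"
    by (auto simp: N_def)
  \<comment> \<open>The eigenvalue difference splits into exactly the two factors that the two
    absorption identities consume.\<close>
  have "jacobi_eig (Suc s) - jacobi_eig n = real (Suc k) * (N - 1 - real k)"
    using k(2) by (simp add: jacobi_eig_def N_def algebra_simps)
  moreover have "real (Suc k) * (N gchoose Suc k) = N * ((N - 1) gchoose k)"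
    by (rule gbinomial_absorption)
  moreover have "(N - 1 - real k) * ((N - 1) gchoose k) = (N - 1) * ((N - 1 - 1) gchoose k)"
    by (rule gbinomial_absorb_comp)
  ultimately have "(N gchoose Suc k) * (jacobi_eig (Suc s) - jacobi_eig n) = N * (N - 1) * ((N - 1 - 1) gchoose k)"
    by (metis (no_types, opaque_lifting) mult.assoc mult.commute)
  then show ?thesis
    unfolding expansion_coeff_def N k(1) k_def[symmetric] by (simp add: N_def)
qed

text \<open>Both sides obey the same recursion under \<open>jacobi_op\<close>, so by induction their difference is an
  eigenpolynomial; it vanishes because the coefficients of degree \<open>s\<close> agree.\<close>

lemma bsum_expansion_poly:
  "(\<Sum>n\<le>s. smult (expansion_coeff s n * poly (jacobi_pol n) y / jacobi_sqnorm n) (jacobi_pol n)) =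
   smult (Gamma (\<kappa> + 2 * real s) / (Gamma (\<alpha> + 1) * Gamma (\<beta> + 1))) (bsum s y (1 - y))"
proof (induction s)
  define T where "T s = (\<Sum>n\<le>s. smult (expansion_coeff s n * poly (jacobi_pol n) y / jacobi_sqnorm n) (jacobi_pol n))" for s
  define G where "G s = smult (Gamma (\<kappa> + 2 * real s) / (Gamma (\<alpha> + 1) * Gamma (\<beta> + 1))) (bsum s y (1 - y))" for s
  have nz: "Gamma (\<alpha> + 1) \<noteq> 0" "Gamma (\<beta> + 1) \<noteq> 0"
    using Gamma_pos(1,2) by (simp_all del: Gamma_pos)
  have deg: "degree (jacobi_pol n) \<le> n" for n
    using degree_bsum[of n "-1" 1] by (simp add: jacobi_pol_def)
  have degT: "degree (T s - G s) \<le> s" for s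
    unfolding T_def G_def
    by (intro degree_diff_le degree_sum_le order_trans[OF degree_smult_le] degree_bsum)
       (auto intro: order_trans[OF deg])
  have top: "coeff (T s - G s) s = 0" for s
  proof -
    have "coeff (T s) s = expansion_coeff s s * poly (jacobi_pol s) y / jacobi_sqnorm s * coeff (jacobi_pol s) s"
      unfolding T_def coeff_sum
      by (subst sum.remove[of _ s]) (auto intro!: sum.neutral coeff_eq_0 le_less_trans[OF deg])
    \<comment> \<open>The norm formula cancels the leading coefficient of
      \<open>jacobi_pol s\<close> and leaves the sign and the Gamma quotient, as
      \<open>coeff_bsum_top\<close> requires.\<close>
    also have "\<dots> = coeff (G s) s"
      using Gamma_pos(3)[of "2 * s"] nz coeff_jacobi_pol_top[of s]
      by (simp add: expansion_coeff_def G_def coeff_bsum_top jacobi_sqnorm_eq minus_one_power_iff del: Gamma_pos)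
    finally show ?thesis
      by simp
  qed
  {
    case 0
    have "jacobi_op (T 0 - G 0) = smult (- jacobi_eig 0) (T 0 - G 0)"
      by (simp add: T_def G_def jacobi_pol_def jacobi_op_diff jacobi_op_smult jacobi_op_bsum_0 jacobi_eig_def)
    from eigenpoly_unique[OF this degT top] show ?case
      by (simp add: T_def G_def)
  next
    case (Suc s)
    define c where "c = (2 * real s + \<kappa> + 1) * (2 * real s + \<kappa>)"
    have IH: "T s = G s"
      using Suc by (simp add: T_def G_def)
    have "jacobi_op (T (Suc s)) = (\<Sum>n\<le>Suc s. smult (expansion_coeff (Suc s) n * poly (jacobi_pol n) y / jacobi_sqnorm n * (- jacobi_eig (Suc s) + (jacobi_eig (Suc s) - jacobi_eig n))) (jacobi_pol n))"
      unfolding T_def jacobi_op_sum jacobi_op_smult jacobi_op_jacobi_pol by (simp del: sum.atMost_Suc)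
    also have "\<dots> = smult (- jacobi_eig (Suc s)) (T (Suc s)) +
        (\<Sum>n\<le>Suc s. smult (expansion_coeff (Suc s) n * (jacobi_eig (Suc s) - jacobi_eig n) * poly (jacobi_pol n) y / jacobi_sqnorm n) (jacobi_pol n))"
      unfolding T_def smult_sum_right smult_smult sum.distrib[symmetric] smult_add_left[symmetric]
      by (rule sum.cong[OF refl], rule arg_cong2[where f = smult]) (auto simp: algebra_simps diff_divide_distrib)
    \<comment> \<open>The term \<open>n = Suc s\<close> drops out, its eigenvalue difference being
      0.\<close>
    also have "(\<Sum>n\<le>Suc s. smult (expansion_coeff (Suc s) n * (jacobi_eig (Suc s) - jacobi_eig n) * poly (jacobi_pol n) y / jacobi_sqnorm n) (jacobi_pol n)) = smult c (T s)"
      unfolding sum.atMost_Suc T_def smult_sum_right smult_smult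
      by (simp add: expansion_coeff_jacobi_eig c_def mult.assoc)
    finally have T: "jacobi_op (T (Suc s)) = smult (- jacobi_eig (Suc s)) (T (Suc s)) + smult c (T s)" .
    have "\<kappa> + 2 * real s > 0"
      using \<alpha> \<beta> by simp
    then have "Gamma (\<kappa> + 2 * real (Suc s)) = c * Gamma (\<kappa> + 2 * real s)"
      using Gamma_add_nat[of "\<kappa> + 2 * real s" 2]
      by (simp add: c_def pochhammer_Suc numeral_2_eq_2 algebra_simps)
    note Gam = this
    have "jacobi_op (G (Suc s)) = smult (- jacobi_eig (Suc s)) (G (Suc s)) + smult c (G s)"
      unfolding G_def jacobi_op_smult jacobi_op_bsum_Suc Gam by (rule poly_eqI) (simp add: algebra_simps)
    with T IH have "jacobi_op (T (Suc s) - G (Suc s)) = smult (- jacobi_eig (Suc s)) (T (Suc s) - G (Suc s))"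
      by (simp add: jacobi_op_diff smult_diff_right)
    from eigenpoly_unique[OF this degT top] show ?case
      by (simp add: T_def G_def)
  }
qed

lemma bsum_expansion:
  "(\<Sum>n\<le>s. expansion_coeff s n * jacobi_product x y n) =
   Gamma (\<kappa> + 2 * real s) / (Gamma (\<alpha> + 1) * Gamma (\<beta> + 1)) * poly (bsum s y (1 - y)) x"
  using arg_cong[OF bsum_expansion_poly[of s y], of "\<lambda>p. poly p x"]
  by (simp add: poly_sum jacobi_product_def mult_ac)

end

section \<open>The Poisson kernel as a power series\<close>

lemma summable_on_triangle_iff:
  fixes h :: "nat \<Rightarrow> nat \<Rightarrow> real"
  shows "(\<lambda>(n, m). h n m) summable_on UNIV \<times> UNIV \<longleftrightarrow>
         (\<lambda>(s, n). h n (s - n)) summable_on (SIGMA s:UNIV. {..s})"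
  by (rule summable_on_reindex_bij_witness[of _ "\<lambda>(s, n). (n, s - n)" "\<lambda>(n, m). (n + m, n)"]) auto

lemma has_sum_triangle_iff:
  fixes h :: "nat \<Rightarrow> nat \<Rightarrow> real"
  shows "((\<lambda>(n, m). h n m) has_sum S) (UNIV \<times> UNIV) \<longleftrightarrow>
         ((\<lambda>(s, n). h n (s - n)) has_sum S) (SIGMA s:UNIV. {..s})"
  by (rule has_sum_reindex_bij_witness[of _ "\<lambda>(s, n). (n, s - n)" "\<lambda>(n, m). (n + m, n)"]) auto

lemma summable_on_triangle:
  fixes h :: "nat \<Rightarrow> nat \<Rightarrow> real"
  assumes "\<And>n m. h n m \<ge> 0" "summable (\<lambda>s. \<Sum>n\<le>s. h n (s - n))"
  shows "(\<lambda>(n, m). h n m) summable_on UNIV \<times> UNIV"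
  unfolding summable_on_triangle_iff
proof (rule summable_on_SigmaI)
  show "(\<lambda>s. \<Sum>n\<le>s. h n (s - n)) summable_on UNIV"
    using assms by (intro summable_nonneg_imp_summable_on) (auto intro!: sum_nonneg)
qed (use assms in \<open>auto intro!: has_sum_finiteI\<close>)

text \<open>Unordered summability over the quadrant permits regrouping the rows into the diagonals
  \<open>n + m = s\<close>.\<close>

lemma triangle_sums:
  fixes h :: "nat \<Rightarrow> nat \<Rightarrow> real"
  assumes "(\<lambda>(n, m). h n m) summable_on UNIV \<times> UNIV" "\<And>n. (\<lambda>m. h n m) sums R n"
  shows "R sums (\<Sum>s. \<Sum>n\<le>s. h n (s - n))"
proof -
  obtain S where S: "((\<lambda>(n, m). h n m) has_sum S) (UNIV \<times> UNIV)"
    using assms(1) by (auto simp: summable_on_def)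
  have "((\<lambda>s. \<Sum>n\<le>s. h n (s - n)) has_sum S) UNIV"
    using S unfolding has_sum_triangle_iff
    by (rule has_sum_SigmaD) (auto intro!: has_sum_finiteI)
  then have *: "(\<lambda>s. \<Sum>n\<le>s. h n (s - n)) sums S"
    by (rule has_sum_imp_sums)
  have "(R has_sum S) UNIV"
    using S
  proof (rule has_sum_SigmaD)
    fix n
    have "h n summable_on UNIV"
      using summable_on_SigmaD1[OF assms(1), of n] by simp
    then obtain R' where R': "(h n has_sum R') UNIV"
      by (auto simp: summable_on_def)
    with assms(2)[of n] have "R' = R n"
      by (metis has_sum_imp_sums sums_unique2)
    with R' show "((\<lambda>m. case (n, m) of (n, m) \<Rightarrow> h n m) has_sum R n) UNIV"
      by simp
  qed
  then show ?thesis
    using * has_sum_imp_sums sums_unique by metis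
qed

context jacobi
begin

definition kernel_coeff :: "real \<Rightarrow> real \<Rightarrow> nat \<Rightarrow> real" where
  "kernel_coeff x y s = Gamma (\<kappa> + 2 * real s) / (Gamma (\<alpha> + 1) * Gamma (\<beta> + 1)) * poly (bsum s y (1 - y)) x"

lemma jacobi_product_diag_nonneg: "jacobi_product x x n \<ge> 0"
  using jacobi_sqnorm_pos[of n] by (simp add: jacobi_product_def)

text \<open>The inequality \<open>2 |p q| \<le> p^2 + q^2\<close> reduces absolute convergence to
  the two diagonal kernels.\<close>

lemma abs_jacobi_product_le: "\<bar>jacobi_product x y n\<bar> \<le> jacobi_product x x n + jacobi_product y y n"
proof -
  define p q where "p = poly (jacobi_pol n) x" and "q = poly (jacobi_pol n) y"
  have "2 * \<bar>p\<bar> * \<bar>q\<bar> \<le> \<bar>p\<bar>\<^sup>2 + \<bar>q\<bar>\<^sup>2"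
    by (rule sum_squares_bound)
  then have "2 * \<bar>p * q\<bar> \<le> p * p + q * q"
    by (simp add: abs_mult power2_eq_square)
  then have "\<bar>p * q\<bar> \<le> p * p + q * q"
    using abs_ge_zero[of "p * q"] by linarith
  then have "\<bar>p * q\<bar> / jacobi_sqnorm n \<le> (p * p + q * q) / jacobi_sqnorm n"
    using jacobi_sqnorm_pos[of n] by (intro divide_right_mono) auto
  then show ?thesis
    using jacobi_sqnorm_pos[of n] by (simp add: jacobi_product_def p_def q_def add_divide_distrib)
qed

lemma expansion_coeff_shifted_central_binomial: "n \<le> s \<Longrightarrow> expansion_coeff s n = shifted_central_binomial (2 * real n + \<kappa> - 1) (s - n)"
  by (simp add: expansion_coeff_def shifted_central_binomial_def of_nat_diff algebra_simps)

text \<open>For \<open>\<mu> = 2 n + \<kappa> - 1\<close> the generating function contains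
  \<open>(1 + r)^(2n)\<close>, which cancels the denominator of \<open>x^n\<close>. Only
  \<open>r^n\<close> still depends on \<open>n\<close>.\<close>

lemma shifted_central_binomial_row_sums:
  assumes "0 < r" "r < 1"
  defines "x \<equiv> r / (1 + r)\<^sup>2"
  shows "(\<lambda>m. x ^ (n + m) * shifted_central_binomial (2 * real n + \<kappa> - 1) m) sums (r ^ n * ((1 + r) powr \<kappa> / (1 - r)))"
proof -
  have mu: "2 * real n + \<kappa> - 1 > -1"
    using \<alpha> \<beta> by simp
  have "(1 - r) ^ 2 > 0"
    using assms by simp
  then have "4 * r < (1 + r) ^ 2"
    by (simp add: power2_eq_square algebra_simps)
  then have "\<bar>x\<bar> < 1 / 4"
    using assms by (simp add: x_def abs_if field_simps)
  then have "(\<lambda>m. x ^ n * (shifted_central_binomial (2 * real n + \<kappa> - 1) m * x ^ m)) sums (x ^ n * binomial_gf (2 * real n + \<kappa> - 1) x)"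
    unfolding binomial_gf_def by (intro sums_mult summable_sums summable_shifted_central_binomial mu)
  also have "x ^ n * binomial_gf (2 * real n + \<kappa> - 1) x = r ^ n * ((1 + r) powr \<kappa> / (1 - r))"
  proof -
    have "(1 + r) powr (2 * real n + \<kappa> - 1 + 1) = (1 + r) powr \<kappa> * ((1 + r)\<^sup>2) ^ n"
      using assms powr_realpow[of "1 + r" "2 * n", unfolded power_mult] by (simp add: powr_add mult_ac)
    then show ?thesis
      unfolding x_def binomial_gf_eq[OF mu assms(1,2)] using assms by (simp add: power_divide)
  qed
  finally show ?thesis
    by (simp add: power_add mult_ac)
qed

text \<open>On the diagonal \<open>x = y\<close> all terms of the double series are nonnegative, which yields absolute
  convergence in general without any pointwise bound for the Jacobi polynomials.\<close>

lemma jacobi_product_sums: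
  assumes r: "0 < r" "r < 1"
  defines "X \<equiv> r / (1 + r)\<^sup>2"
  assumes sx: "summable (\<lambda>s. kernel_coeff x x s * X ^ s)" and sy: "summable (\<lambda>s. kernel_coeff y y s * X ^ s)"
  shows "(\<lambda>n. jacobi_product x y n * r ^ n) sums ((1 - r) / (1 + r) powr \<kappa> * (\<Sum>s. kernel_coeff x y s * X ^ s))"
proof -
  define B where "B n m = X ^ (n + m) * shifted_central_binomial (2 * real n + \<kappa> - 1) m" for n m
  have X: "X > 0"
    using r by (simp add: X_def)
  have B: "B n m \<ge> 0" for n m
    unfolding B_def using X \<alpha> \<beta> by (intro mult_nonneg_nonneg less_imp_le[OF shifted_central_binomial_pos]) auto
  \<comment> \<open>The columns of the triangle carry the expansion coefficients, so a diagonal sum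
    is one coefficient of the power series in \<open>X\<close>.\<close>
  have tri: "(\<Sum>n\<le>s. jacobi_product x y n * B n (s - n)) = kernel_coeff x y s * X ^ s" for x y s
  proof -
    have "(\<Sum>n\<le>s. jacobi_product x y n * B n (s - n)) = (\<Sum>n\<le>s. expansion_coeff s n * jacobi_product x y n) * X ^ s"
      unfolding sum_distrib_right by (rule sum.cong) (auto simp: B_def expansion_coeff_shifted_central_binomial)
    then show ?thesis
      by (simp add: kernel_coeff_def bsum_expansion)
  qed
  have diag: "(\<lambda>(n, m). jacobi_product x x n * B n m) summable_on UNIV \<times> UNIV" if "summable (\<lambda>s. kernel_coeff x x s * X ^ s)" for x
    using that by (intro summable_on_triangle mult_nonneg_nonneg B jacobi_product_diag_nonneg) (simp add: tri)
  have "(\<lambda>(n, m). jacobi_product x x n * B n m + jacobi_product y y n * B n m) summable_on UNIV \<times> UNIV"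
    using summable_on_add[OF diag[OF sx] diag[OF sy]] by (simp add: case_prod_unfold)
  then have "(\<lambda>p. norm (case p of (n, m) \<Rightarrow> jacobi_product x y n * B n m)) summable_on UNIV \<times> UNIV"
    by (rule Infinite_Sum.abs_summable_on_comparison_test')
       (auto simp: abs_mult B mult_right_mono abs_jacobi_product_le simp flip: distrib_right)
  then have "(\<lambda>(n, m). jacobi_product x y n * B n m) summable_on UNIV \<times> UNIV"
    by (rule abs_summable_summable)
  moreover have "(\<lambda>m. jacobi_product x y n * B n m) sums (jacobi_product x y n * (r ^ n * ((1 + r) powr \<kappa> / (1 - r))))" for n
    unfolding B_def X_def by (intro sums_mult shifted_central_binomial_row_sums r)
  ultimately have "(\<lambda>n. jacobi_product x y n * (r ^ n * ((1 + r) powr \<kappa> / (1 - r)))) sums (\<Sum>s. kernel_coeff x y s * X ^ s)"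
    using triangle_sums[of "\<lambda>n m. jacobi_product x y n * B n m"] by (simp add: tri)
  from sums_mult[OF this, of "(1 - r) / (1 + r) powr \<kappa>"] show ?thesis
    using r by simp
qed

end

section \<open>Moments of the measures\<close>

text \<open>For \<open>\<gamma> > -1/2\<close> this is \<open>2 \<integral>\<^bsub>(0,1]\<^esub> u\<^bsup>2i\<^esup> d\<Pi>\<^sub>\<gamma>\<close>; for smaller \<open>\<gamma>\<close> only its difference from \<open>1\<close> is a
  convergent integral.\<close>

definition Pi_moment :: "real \<Rightarrow> nat \<Rightarrow> real" where
  "Pi_moment \<gamma> i = pochhammer (1 / 2) i / pochhammer (\<gamma> + 1) i"

lemma Pi_moment_0 [simp]: "Pi_moment \<gamma> 0 = 1"
  by (simp add: Pi_moment_def)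

lemma Pi_moment_Suc: "Pi_moment \<gamma> (Suc i) = Pi_moment \<gamma> i * ((real i + 1 / 2) / (real i + \<gamma> + 1))"
  by (simp add: Pi_moment_def pochhammer_Suc add_ac)

lemma Pi_moment_nonneg: "\<gamma> > -1 \<Longrightarrow> Pi_moment \<gamma> i \<ge> 0"
  by (auto simp: Pi_moment_def intro!: divide_nonneg_nonneg pochhammer_nonneg)

text \<open>The true growth is that of \<open>i powr (- \<gamma> - 1/2)\<close>, below a square
  root; a linear bound suffices against geometric decay.\<close>

lemma Pi_moment_le:
  assumes "\<gamma> > -1"
  shows "Pi_moment \<gamma> i \<le> (1 + 1 / (\<gamma> + 1)) * (real i + 1)"
proof (induction i)
  case 0
  show ?case
    using assms by simp
next
  case (Suc i)
  define K where "K = 1 + 1 / (\<gamma> + 1)"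
  have K: "K \<ge> 1" "K \<ge> 1 / (\<gamma> + 1)"
    using assms by (auto simp: K_def)
  show ?case
  \<comment> \<open>The first quotient, \<open>1 / (2 (\<gamma> + 1))\<close>, is unbounded as
    \<open>\<gamma>\<close> approaches -1 and is absorbed in the constant; later ones are at most
    \<open>(i + 2) / (i + 1)\<close>.\<close>
  proof (cases "i = 0")
    case True
    have "1 / 2 / (\<gamma> + 1) \<le> 1 / (\<gamma> + 1)"
      using assms by (intro divide_right_mono) auto
    then show ?thesis
      using K unfolding K_def[symmetric] by (simp add: True Pi_moment_Suc)
  next
    case False
    then have i: "real i \<ge> 1"
      by simp
    have "(real i + 1 / 2) * (real i + 1) \<le> (real i + 2) * (real i + \<gamma> + 1)"
    proof -
      have "(real i + 2) * real i \<le> (real i + 2) * (real i + \<gamma> + 1)"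
        using assms by (intro mult_left_mono) auto
      moreover have "(real i + 1 / 2) * (real i + 1) \<le> (real i + 2) * real i"
        using i by (simp add: algebra_simps)
      ultimately show ?thesis
        by linarith
    qed
    then have *: "(real i + 1) * ((real i + 1 / 2) / (real i + \<gamma> + 1)) \<le> real i + 2"
      using assms i by (simp add: field_simps)
    have "Pi_moment \<gamma> (Suc i) \<le> K * (real i + 1) * ((real i + 1 / 2) / (real i + \<gamma> + 1))"
      unfolding Pi_moment_Suc using Suc assms by (intro mult_right_mono) (auto simp: K_def)
    also have "\<dots> \<le> K * (real i + 2)"
      unfolding mult.assoc using K * by (intro mult_left_mono) auto
    finally show ?thesis
      by (simp add: K_def add_ac)
  qed
qed

lemma abs_one_minus_Pi_moment_le:
  assumes "\<gamma> > -1" "i \<le> s"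
  shows "\<bar>1 - Pi_moment \<gamma> i\<bar> / 2 \<le> (1 + 1 / (\<gamma> + 1)) * (real s + 1)"
proof -
  define K where "K = 1 + 1 / (\<gamma> + 1)"
  have K: "K \<ge> 1"
    using assms by (simp add: K_def)
  have "Pi_moment \<gamma> i \<le> K * (real i + 1)"
    using Pi_moment_le[OF assms(1)] by (simp add: K_def)
  also have "\<dots> \<le> K * (real s + 1)"
    using K assms by (intro mult_left_mono) auto
  finally have "Pi_moment \<gamma> i \<le> K * (real s + 1)" .
  moreover have "1 * 1 \<le> K * (real s + 1)"
    using K by (intro mult_mono) auto
  ultimately show ?thesis
    using Pi_moment_nonneg[OF assms(1), of i] unfolding K_def[symmetric] by (simp add: abs_if)
qed

lemma Beta_half_integral:
  assumes "\<delta> > -1"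
  shows "has_bochner_integral lborel (\<lambda>u. indicator {0<..1} u * (u ^ (2 * l) * (1 - u\<^sup>2) powr \<delta>))
           (Beta (real l + 1 / 2) (\<delta> + 1) / 2)"
proof -
  define f where "f t = t powr (real l + 1 / 2 - 1) * (1 - t) powr (\<delta> + 1 - 1)" for t
  have pos: "real l + 1 / 2 > 0" "\<delta> + 1 > 0"
    using assms by auto
  have f: "set_integrable lborel {0\<^sup>2..1\<^sup>2} f"
    using integrable_Beta[OF pos] by (simp add: f_def[abs_def])
  have d: "((\<lambda>u::real. u\<^sup>2) has_real_derivative 2 * x) (at x)" for x
    by (auto intro!: derivative_eq_intros)
  have c: "continuous_on {0..1} (\<lambda>x::real. 2 * x)"
    by (intro continuous_intros)
  have 1: "set_integrable lborel {0..1} (\<lambda>x. f (x\<^sup>2) * (2 * x))"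
    "(LBINT x. f x * indicator {0..1} x) = (LBINT x. f (x\<^sup>2) * (2 * x) * indicator {0..1} x)"
    using integral_substitution[where g = "\<lambda>u. u\<^sup>2" and a = 0 and b = 1 and g' = "\<lambda>x. 2 * x", OF f d c] by simp_all
  have "(LBINT x:{0..1}. f x) = integral {0..1} f"
    using f by (intro set_borel_integral_eq_integral) simp
  also have "\<dots> = Beta (real l + 1 / 2) (\<delta> + 1)"
    using has_integral_Beta_real[OF pos] by (intro integral_unique) (simp add: f_def[abs_def])
  finally have "has_bochner_integral lborel (\<lambda>x. indicator {0..1} x * (f (x\<^sup>2) * (2 * x)) / 2) (Beta (real l + 1 / 2) (\<delta> + 1) / 2)"
    using 1 by (intro has_bochner_integral_divide_zero)
      (simp add: has_bochner_integral_iff set_integrable_def set_lebesgue_integral_def mult_ac)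
  \<comment> \<open>At 0 the left side vanishes through the factor \<open>2 x\<close>, whereas
    \<open>u ^ (2 * l)\<close> is 1 there for \<open>l = 0\<close>; hence the half-open
    interval.\<close>
  moreover have "indicator {0..1} x * (f (x\<^sup>2) * (2 * x)) / 2 = indicator {0<..1} x * (x ^ (2 * l) * (1 - x\<^sup>2) powr \<delta>)" for x
  proof (cases "x \<in> {0<..1}")
    case True
    then have x: "x > 0" by simp
    have "(x\<^sup>2) powr (real l + 1 / 2 - 1) = x powr (2 * real l - 1)"
      using x powr_powr[of x 2 "real l + 1 / 2 - 1"] by (simp add: algebra_simps)
    also have "\<dots> * x = x powr (2 * real l)"
      using x by (simp add: powr_diff)
    also have "\<dots> = x ^ (2 * l)"
      using powr_realpow[OF x, of "2 * l"] by simp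
    finally show ?thesis
      using True by (simp add: f_def)
  qed (auto simp: indicator_def)
  ultimately show ?thesis
    by simp
qed

text \<open>A telescoping sum that mirrors
  \<open>1 - u^(2i) = (1 - u^2) (1 + u^2 + ... + u^(2i-2))\<close> term by term.\<close>

lemma one_minus_Pi_moment:
  assumes "\<gamma> > -1"
  shows "1 - Pi_moment \<gamma> i = (\<gamma> + 1 / 2) * (\<Sum>l<i. pochhammer (1 / 2) l / pochhammer (\<gamma> + 1) (Suc l))"
proof (induction i)
  case (Suc i)
  have "real i + \<gamma> + 1 > 0" "pochhammer (\<gamma> + 1) i > 0"
    using assms by (auto intro!: pochhammer_pos)
  then have "Pi_moment \<gamma> i - Pi_moment \<gamma> (Suc i) = (\<gamma> + 1 / 2) * (pochhammer (1 / 2) i / pochhammer (\<gamma> + 1) (Suc i))"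
    by (simp add: Pi_moment_def pochhammer_Suc divide_simps) (simp add: algebra_simps)
  then show ?case
    using Suc by (simp add: distrib_left)
qed simp

text \<open>Dividing out \<open>1 - u^2\<close> raises the exponent of the density to
  \<open>\<gamma> + 1/2 > -1/2\<close>, and each remaining term is a convergent Beta integral,
  whatever the sign of the density.\<close>

lemma Pi_integral_power:
  assumes \<gamma>: "\<gamma> > -1"
  shows "has_bochner_integral (Pi_ref \<gamma>)
    (\<lambda>u. indicator {0<..1} u * ((1 - u ^ (2 * i)) * Pi_density \<gamma> u)) ((1 - Pi_moment \<gamma> i) / 2)"
proof (cases "\<gamma> = - 1 / 2")
  case True
  have "Pi_moment \<gamma> i = 1"
    by (simp add: True Pi_moment_def pochhammer_eq_0_iff)
  \<comment> \<open>Only the atom at 1 lies in (0,1], and \<open>1 - u ^ (2 * i)\<close> vanishes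
    there.\<close>
  moreover have "has_bochner_integral (point_measure {-1, 1} (\<lambda>_. 1 / 2))
    (\<lambda>u. indicator {0<..1} u * ((1 - u ^ (2 * i)) * Pi_density \<gamma> u)) 0"
    by (subst has_bochner_integral_cong[of _ _ _ "\<lambda>_. 0"])
       (auto simp: space_point_measure has_bochner_integral_zero)
  then have "has_bochner_integral (distr (point_measure {-1, 1} (\<lambda>_. 1 / 2)) borel (\<lambda>u. u))
    (\<lambda>u. indicator {0<..1} u * ((1 - u ^ (2 * i)) * Pi_density \<gamma> u)) 0"
    by (intro has_bochner_integral_distr) (auto simp: True Pi_density_def)
  ultimately show ?thesis
    by (simp add: Pi_ref_def True)
next
  case False
  define \<delta> C where "\<delta> = \<gamma> + 1 / 2" and "C = Gamma (\<gamma> + 1) / (sqrt pi * Gamma \<delta>)"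
  have \<delta>: "\<delta> > - 1 / 2" "\<delta> \<noteq> 0"
    using False \<gamma> by (auto simp: \<delta>_def)
  have "\<delta> \<notin> \<int>\<^sub>\<le>\<^sub>0"
  proof
    assume "\<delta> \<in> \<int>\<^sub>\<le>\<^sub>0"
    then obtain n where "\<delta> = - of_nat n"
      by (auto elim!: nonpos_Ints_cases')
    with \<delta> show False
      by (cases n) auto
  qed
  \<comment> \<open>This is the source of the factor \<open>\<gamma> + 1/2\<close> in
    \<open>one_minus_Pi_moment\<close>: the quotient of \<open>Gamma (\<delta> + 1)\<close> from the
    Beta function and \<open>Gamma \<delta>\<close> from the density.\<close>
  then have Gd: "Gamma (\<delta> + 1) = \<delta> * Gamma \<delta>" "Gamma \<delta> \<noteq> 0"
    by (simp_all add: Gamma_plus1 Gamma_eq_zero_iff)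
  have Gg: "Gamma (\<gamma> + 1) > 0"
    using \<gamma> by (intro Gamma_real_pos) auto
  have B: "C * (Beta (real l + 1 / 2) (\<delta> + 1) / 2) = (\<gamma> + 1 / 2) * (pochhammer (1 / 2) l / pochhammer (\<gamma> + 1) (Suc l)) / 2" for l
  proof -
    have "Gamma (real l + 1 / 2) = pochhammer (1 / 2) l * sqrt pi"
      using Gamma_add_nat[of "1 / 2" l] by (simp add: Gamma_one_half_real add.commute)
    moreover have "Gamma (real l + 1 / 2 + (\<delta> + 1)) = pochhammer (\<gamma> + 1) (Suc l) * Gamma (\<gamma> + 1)"
      using Gamma_add_nat[of "\<gamma> + 1" "Suc l"] \<gamma> by (simp add: \<delta>_def add_ac)
    ultimately show ?thesis
      using Gg Gd(2) unfolding Beta_def Gd(1) C_def by (simp add: \<delta>_def[symmetric])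
  qed
  have "has_bochner_integral lborel (\<lambda>u. \<Sum>l<i. C * (indicator {0<..1} u * (u ^ (2 * l) * (1 - u\<^sup>2) powr \<delta>)))
      (\<Sum>l<i. C * (Beta (real l + 1 / 2) (\<delta> + 1) / 2))"
    using \<delta> by (intro has_bochner_integral_sum has_bochner_integral_mult_right Beta_half_integral) auto
  also have "(\<Sum>l<i. C * (Beta (real l + 1 / 2) (\<delta> + 1) / 2)) = (1 - Pi_moment \<gamma> i) / 2"
    unfolding B one_minus_Pi_moment[OF \<gamma>] by (simp add: sum_distrib_left sum_divide_distrib)
  also have "(\<lambda>u. \<Sum>l<i. C * (indicator {0<..1} u * (u ^ (2 * l) * (1 - u\<^sup>2) powr \<delta>))) =
    (\<lambda>u. indicator {-1<..<1} u *\<^sub>R (indicator {0<..1} u * ((1 - u ^ (2 * i)) * Pi_density \<gamma> u)))"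
  proof
    fix u :: real
    consider "u \<notin> {0<..1}" | "u = 1" | "0 < u" "u < 1"
      by (auto simp: not_less) linarith
    then show "(\<Sum>l<i. C * (indicator {0<..1} u * (u ^ (2 * l) * (1 - u\<^sup>2) powr \<delta>))) =
      indicator {-1<..<1} u *\<^sub>R (indicator {0<..1} u * ((1 - u ^ (2 * i)) * Pi_density \<gamma> u))"
    proof cases
      case 3
      have u2: "1 - u\<^sup>2 > 0"
        using 3 by (simp add: power_less_one_iff abs_square_less_1)
      have "(1 - u ^ (2 * i)) * Pi_density \<gamma> u = (1 - (u\<^sup>2) ^ i) * (C * (1 - u\<^sup>2) powr (\<delta> - 1))"
        using False by (simp add: Pi_density_def C_def \<delta>_def power_mult)
      also have "(1 - (u\<^sup>2) ^ i) = (1 - u\<^sup>2) * (\<Sum>l<i. (u\<^sup>2) ^ l)"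
        by (rule one_diff_power_eq)
      also have "(1 - u\<^sup>2) * (\<Sum>l<i. (u\<^sup>2) ^ l) * (C * (1 - u\<^sup>2) powr (\<delta> - 1)) =
          C * (\<Sum>l<i. u ^ (2 * l)) * (1 - u\<^sup>2) powr \<delta>"
        using u2 by (simp add: powr_diff power_mult)
      finally show ?thesis
        using 3 by (simp add: sum_distrib_left sum_distrib_right mult_ac)
    qed auto
  qed
  finally have "has_bochner_integral (density lborel (indicator {-1<..<1}))
    (\<lambda>u. indicator {0<..1} u * ((1 - u ^ (2 * i)) * Pi_density \<gamma> u)) ((1 - Pi_moment \<gamma> i) / 2)"
  proof -
    assume *: "has_bochner_integral lborel
      (\<lambda>u. indicator {-1<..<1} u *\<^sub>R (indicator {0<..1} u * ((1 - u ^ (2 * i)) * Pi_density \<gamma> u))) ((1 - Pi_moment \<gamma> i) / 2)"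
    have "indicator {-1<..<1} = (\<lambda>u::real. ennreal (indicat_real {-1<..<1} u))"
      by (simp add: fun_eq_iff ennreal_indicator)
    then show ?thesis
      using * False by (simp only:, intro has_bochner_integral_density) (auto simp: Pi_density_def)
  qed
  then show ?thesis
    using False by (simp add: Pi_ref_def)
qed

text \<open>On (0,1] the integrand has one sign, that of the density, so its absolute integral is
  the absolute value of its integral.\<close>

lemma Pi_integral_abs_power:
  assumes \<gamma>: "\<gamma> > -1"
  shows "has_bochner_integral (Pi_ref \<gamma>)
    (\<lambda>u. \<bar>indicator {0<..1} u * ((1 - u ^ (2 * i)) * Pi_density \<gamma> u)\<bar>) (\<bar>1 - Pi_moment \<gamma> i\<bar> / 2)"
proof -
  let ?f = "\<lambda>u. indicator {0<..1} u * ((1 - u ^ (2 * i)) * Pi_density \<gamma> u)"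
  define sg :: real where "sg = (if \<gamma> < - 1 / 2 then -1 else 1)"
  have Gg: "Gamma (\<gamma> + 1) > 0"
    using \<gamma> by (intro Gamma_real_pos) auto
  have d: "sg * Pi_density \<gamma> u \<ge> 0" for u
  proof -
    consider "\<gamma> = - 1 / 2" | "\<gamma> > - 1 / 2" | "\<gamma> < - 1 / 2"
      by linarith
    then show ?thesis
    proof cases
      case 2
      then have "Gamma (\<gamma> + 1 / 2) > 0"
        by (intro Gamma_real_pos) auto
      then show ?thesis
        using 2 Gg by (auto simp: sg_def Pi_density_def)
    next
      case 3
      have "\<gamma> + 1 / 2 \<notin> \<int>\<^sub>\<le>\<^sub>0"
      proof
        assume "\<gamma> + 1 / 2 \<in> \<int>\<^sub>\<le>\<^sub>0"
        then obtain n where "\<gamma> + 1 / 2 = - of_nat n"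
          by (auto elim!: nonpos_Ints_cases')
        with 3 \<gamma> show False
          by (cases n) auto
      qed
      \<comment> \<open>The functional equation makes Gamma negative between -1/2 and 0.\<close>
      then have "(\<gamma> + 1 / 2) * Gamma (\<gamma> + 1 / 2) > 0"
        using Gamma_real_pos[of "\<gamma> + 1 / 2 + 1"] Gamma_plus1[of "\<gamma> + 1 / 2"] \<gamma> by linarith
      then have "Gamma (\<gamma> + 1 / 2) < 0"
        using 3 by (simp add: zero_less_mult_iff)
      then show ?thesis
        using 3 Gg by (auto simp: sg_def Pi_density_def divide_nonneg_neg mult_pos_neg
            intro!: mult_nonpos_nonneg divide_nonneg_nonpos mult_nonneg_nonpos)
    qed (auto simp: sg_def Pi_density_def)
  qed
  have "\<bar>?f u\<bar> = sg * ?f u" for u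
  proof (cases "u \<in> {0<..1}")
    case True
    then have "1 - u ^ (2 * i) \<ge> 0"
      by (simp add: power_le_one)
    then have "sg * ?f u \<ge> 0"
      using True mult_nonneg_nonneg[OF _ d, of "1 - u ^ (2 * i)" u] by (simp add: mult_ac)
    moreover have "\<bar>sg * ?f u\<bar> = \<bar>?f u\<bar>"
      by (simp add: sg_def)
    ultimately show ?thesis
      by linarith
  qed simp
  moreover have "has_bochner_integral (Pi_ref \<gamma>) (\<lambda>u. sg * ?f u) (sg * ((1 - Pi_moment \<gamma> i) / 2))"
    by (intro has_bochner_integral_mult_right Pi_integral_power \<gamma>)
  ultimately have *: "has_bochner_integral (Pi_ref \<gamma>) (\<lambda>u. \<bar>?f u\<bar>) (sg * ((1 - Pi_moment \<gamma> i) / 2))"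
    by simp
  have "sg * ((1 - Pi_moment \<gamma> i) / 2) \<ge> 0"
    unfolding has_bochner_integral_integral_eq[OF *, symmetric] by (intro integral_nonneg_AE) auto
  then have "sg * ((1 - Pi_moment \<gamma> i) / 2) = \<bar>1 - Pi_moment \<gamma> i\<bar> / 2"
    by (auto simp: sg_def abs_if split: if_splits)
  with * show ?thesis
    by simp
qed

lemma sigma_finite_Pi_ref: "sigma_finite_measure (Pi_ref \<gamma>)"
proof (cases "\<gamma> = - 1 / 2")
  case True
  have "finite_measure (point_measure {-1, 1 :: real} (\<lambda>_. 1 / 2))"
    by (rule finite_measureI) (simp add: emeasure_point_measure_finite space_point_measure ennreal_mult_eq_top_iff ennreal_divide_eq_top_iff)
  then have "finite_measure (distr (point_measure {-1, 1 :: real} (\<lambda>_. 1 / 2)) borel (\<lambda>u. u))"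
    by (rule finite_measure.finite_measure_distr) auto
  then show ?thesis
    using True by (simp add: Pi_ref_def finite_measure.axioms(1) finite_measure_def)
next
  case False
  then show ?thesis
    by (simp add: Pi_ref_def sigma_finite_measure.sigma_finite_iff_density_finite[OF sigma_finite_lborel] indicator_def)
qed

section \<open>Expansion of the symmetrized kernel\<close>

lemma sum_even_index:
  fixes f :: "nat \<Rightarrow> real"
  assumes "\<And>j. odd j \<Longrightarrow> f j = 0"
  shows "(\<Sum>j\<le>2 * s. f j) = (\<Sum>i\<le>s. f (2 * i))"
  using assms by (induction s) auto

definition even_binomial :: "nat \<Rightarrow> real \<Rightarrow> real \<Rightarrow> real" where
  "even_binomial s p q = (\<Sum>i\<le>s. real (2 * s choose (2 * i)) * p ^ (2 * i) * q ^ (2 * (s - i)))"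

lemma even_binomial_eq: "even_binomial s p q = ((p + q) ^ (2 * s) + (p - q) ^ (2 * s)) / 2"
proof -
  have "(p - q) ^ (2 * s) = (- p + q) ^ (2 * s)"
    by (metis even_mult_iff even_numeral minus_diff_eq power_minus_even uminus_add_conv_diff)
  then have "(p + q) ^ (2 * s) + (p - q) ^ (2 * s) = (p + q) ^ (2 * s) + (- p + q) ^ (2 * s)"
    by simp
  also have "\<dots> = (\<Sum>j\<le>2 * s. real (2 * s choose j) * (p ^ j + (- p) ^ j) * q ^ (2 * s - j))"
    unfolding binomial_ring sum.distrib[symmetric] by (simp add: algebra_simps)
  also have "\<dots> = (\<Sum>i\<le>s. real (2 * s choose (2 * i)) * (p ^ (2 * i) + (- p) ^ (2 * i)) * q ^ (2 * s - 2 * i))"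
    by (rule sum_even_index) auto
  also have "\<dots> = 2 * even_binomial s p q"
    by (simp add: even_binomial_def sum_distrib_left diff_mult_distrib diff_mult_distrib2 mult_ac)
  finally show ?thesis
    by simp
qed

text \<open>Reversing both signs multiplies the power by \<open>(-1)^N\<close>; reversing one of
  them keeps the part even in \<open>p\<close>.\<close>

lemma symmetrized_power:
  fixes p q :: real
  shows "(\<Sum>\<xi>\<in>{-1, 1}. \<Sum>\<eta>\<in>{-1, 1}. (\<xi> * p + \<eta> * q) ^ N) =
     (if even N then 4 * even_binomial (N div 2) p q else 0)"
proof (cases "even N")
  case True
  then obtain s where N: "N = 2 * s" by auto
  have "(- p - q) ^ N = (p + q) ^ N" "(q - p) ^ N = (p - q) ^ N"
    using True by (metis minus_add_distrib power_minus_even uminus_add_conv_diff add_uminus_conv_diff)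
      (metis True minus_diff_eq power_minus_even)
  then show ?thesis
    using True by (simp add: N even_binomial_eq)
next
  case False
  have "(- p - q) ^ N = - ((p + q) ^ N)" "(q - p) ^ N = - ((p - q) ^ N)"
    using False by (metis minus_add_distrib power_minus_odd add_uminus_conv_diff)
      (metis False minus_diff_eq power_minus_odd)
  then show ?thesis
    using False by simp
qed

lemma negative_powr_sums:
  fixes k z c :: real
  assumes "\<bar>z\<bar> < k"
  shows "(\<lambda>N. pochhammer c N / fact N * k powr (- c - real N) * z ^ N) sums (1 / (k - z) powr c)"
proof -
  have "(\<lambda>N. (- c gchoose N) * k powr (- c - real N) * (- z) ^ N) sums (k + - z) powr (- c)"
    using assms by (intro gen_binomial_real'') auto
  moreover have "(- c gchoose N) * k powr (- c - real N) * (- z) ^ N = pochhammer c N / fact N * k powr (- c - real N) * z ^ N" for N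
  proof -
    have "(- c gchoose N) * k powr (- c - real N) * (- z) ^ N =
        pochhammer c N / fact N * k powr (- c - real N) * ((-1) ^ N * (- z) ^ N)"
      unfolding gbinomial_pochhammer minus_minus by (simp only: times_divide_eq_left times_divide_eq_right mult_ac)
    also have "(-1) ^ N * (- z) ^ N = z ^ N"
      by (simp flip: power_mult_distrib)
    finally show ?thesis .
  qed
  ultimately show ?thesis
    by (simp add: powr_minus_divide)
qed

text \<open>The weight is the product of the linear growth bounds for the two moment factors. The
  ratio of consecutive terms tends to \<open>1 / k^2 < 1\<close>.\<close>

lemma weighted_pochhammer_summable:
  assumes "c > 0" "k > 1"
  shows "summable (\<lambda>s. (real s + 1)\<^sup>2 * (pochhammer c (2 * s) / fact (2 * s) * k powr (- c - real (2 * s))))"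
proof -
  define f where "f s = (real s + 1)\<^sup>2 * (pochhammer c (2 * s) / fact (2 * s) * k powr (- c - real (2 * s)))" for s
  define \<rho> where "\<rho> s = ((real s + 2) / (real s + 1))\<^sup>2 * ((c + 2 * real s) * (c + 2 * real s + 1) / ((2 * real s + 1) * (2 * real s + 2)))" for s
  have f: "f (Suc s) = \<rho> s * (1 / k\<^sup>2) * f s" for s
  proof -
    have "k powr (- c - real (2 * Suc s)) = k powr (- c - real (2 * s)) * (1 / k\<^sup>2)"
      using assms powr_diff[of k "- c - real (2 * s)" 2] by (simp add: algebra_simps)
    moreover have "pochhammer c (2 * Suc s) = pochhammer c (2 * s) * ((c + 2 * real s) * (c + 2 * real s + 1))"
      by (simp add: pochhammer_Suc add_ac)
    moreover have "fact (2 * Suc s) = (fact (2 * s) * ((2 * real s + 1) * (2 * real s + 2)) :: real)"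
      by (simp add: algebra_simps)
    moreover have "(real (Suc s) + 1)\<^sup>2 = ((real s + 2) / (real s + 1))\<^sup>2 * (real s + 1)\<^sup>2"
      by (simp add: power_divide add_ac)
    ultimately show ?thesis
      unfolding f_def \<rho>_def by (simp only: times_divide_eq_right times_divide_eq_left divide_divide_eq_left mult_1_left mult_1_right mult_ac)
  qed
  have pos: "f s > 0" for s
    unfolding f_def using assms by (intro mult_pos_pos divide_pos_pos pochhammer_pos) auto
  have "\<rho> \<longlonglongrightarrow> 1"
    unfolding \<rho>_def by real_asymp
  then have "(\<lambda>s. \<rho> s * (1 / k\<^sup>2)) \<longlonglongrightarrow> 1 * (1 / k\<^sup>2)"
    by (intro tendsto_intros)
  moreover have k2: "1 / k\<^sup>2 < 1"
    using assms by (simp add: power_strict_increasing[of 0 2 k, simplified])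
  ultimately have "eventually (\<lambda>s. \<rho> s * (1 / k\<^sup>2) < (1 + 1 / k\<^sup>2) / 2) sequentially"
    by (intro order_tendstoD(2)) auto
  then obtain N where N: "\<And>s. s \<ge> N \<Longrightarrow> \<rho> s * (1 / k\<^sup>2) < (1 + 1 / k\<^sup>2) / 2"
    by (auto simp: eventually_sequentially)
  have "summable f"
  proof (rule summable_ratio_test[of "(1 + 1 / k\<^sup>2) / 2" N])
    show "norm (f (Suc s)) \<le> (1 + 1 / k\<^sup>2) / 2 * norm (f s)" if "s \<ge> N" for s
    proof -
      have "f (Suc s) \<le> (1 + 1 / k\<^sup>2) / 2 * f s"
        unfolding f using N[OF that] pos[of s] by (intro mult_right_mono) auto
      then show ?thesis
        using pos[of s] pos[of "Suc s"] by simp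
    qed
  qed (use k2 in auto)
  then show ?thesis
    by (simp add: f_def[abs_def])
qed

context jacobi
begin

definition Psi_E_coeff :: "real \<Rightarrow> real \<Rightarrow> real \<Rightarrow> nat \<Rightarrow> nat \<Rightarrow> real" where
  "Psi_E_coeff t \<theta> \<phi> s i = c_const \<alpha> \<beta> * sinh (t / 2) *
     (pochhammer \<kappa> (2 * s) / fact (2 * s) * cosh (t / 2) powr (- \<kappa> - real (2 * s))) *
     (real (2 * s choose (2 * i)) * (sin (\<theta> / 2) * sin (\<phi> / 2)) ^ (2 * i) * (cos (\<theta> / 2) * cos (\<phi> / 2)) ^ (2 * (s - i)))"

lemma c_const_pos: "c_const \<alpha> \<beta> > 0"
  using \<alpha> \<beta> Gamma_pos(3)[of 0] by (auto simp: c_const_def intro!: divide_pos_pos mult_pos_pos)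

lemma half_angle_bound:
  assumes "\<theta> \<in> {0..pi}" "\<phi> \<in> {0..pi}"
  shows "sin (\<theta> / 2) * sin (\<phi> / 2) \<ge> 0" "cos (\<theta> / 2) * cos (\<phi> / 2) \<ge> 0"
    "sin (\<theta> / 2) * sin (\<phi> / 2) + cos (\<theta> / 2) * cos (\<phi> / 2) \<le> 1"
proof -
  show "sin (\<theta> / 2) * sin (\<phi> / 2) \<ge> 0" "cos (\<theta> / 2) * cos (\<phi> / 2) \<ge> 0"
    using assms by (auto intro!: mult_nonneg_nonneg sin_ge_zero cos_ge_zero)
  show "sin (\<theta> / 2) * sin (\<phi> / 2) + cos (\<theta> / 2) * cos (\<phi> / 2) \<le> 1"
    using cos_le_one[of "\<theta> / 2 - \<phi> / 2"] by (simp add: cos_diff)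
qed

lemma Psi_E_coeff_nonneg: "t > 0 \<Longrightarrow> Psi_E_coeff t \<theta> \<phi> s i \<ge> 0"
  unfolding Psi_E_coeff_def using c_const_pos \<alpha> \<beta>
  by (intro mult_nonneg_nonneg divide_nonneg_nonneg pochhammer_nonneg) (auto simp: power_mult)

lemma cosh_half_gt_1: "t > 0 \<Longrightarrow> cosh (t / 2) > (1 :: real)"
  using cosh_real_strict_mono[of 0 "t / 2"] by simp

text \<open>The even binomial sum averages the powers of \<open>p + q\<close> and
  \<open>p - q\<close>. Both are at most 1 in modulus, since
  \<open>p + q = cos ((\<theta> - \<phi>) / 2)\<close>.\<close>

lemma Psi_E_coeff_summable:
  assumes "t > 0" "\<theta> \<in> {0..pi}" "\<phi> \<in> {0..pi}"
  shows "summable (\<lambda>s. (real s + 1)\<^sup>2 * (\<Sum>i\<le>s. Psi_E_coeff t \<theta> \<phi> s i))"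
proof (rule summable_comparison_test')
  let ?w = "\<lambda>s. (real s + 1)\<^sup>2 * (pochhammer \<kappa> (2 * s) / fact (2 * s) * cosh (t / 2) powr (- \<kappa> - real (2 * s)))"
  show "summable (\<lambda>s. c_const \<alpha> \<beta> * sinh (t / 2) * ?w s)"
    using \<alpha> \<beta> cosh_half_gt_1[OF assms(1)] by (intro summable_mult weighted_pochhammer_summable) auto
  fix s :: nat
  define p q where "p = sin (\<theta> / 2) * sin (\<phi> / 2)" and "q = cos (\<theta> / 2) * cos (\<phi> / 2)"
  have pq: "p \<ge> 0" "q \<ge> 0" "p + q \<le> 1"
    using half_angle_bound[OF assms(2,3)] by (auto simp: p_def q_def)
  have "(p + q) ^ (2 * s) \<le> 1"
    using pq by (intro power_le_one) auto
  moreover have "\<bar>(p - q) ^ (2 * s)\<bar> \<le> 1"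
    unfolding power_abs using pq by (intro power_le_one) auto
  ultimately have e: "even_binomial s p q \<le> 1"
    by (simp add: even_binomial_eq)
  have "(\<Sum>i\<le>s. Psi_E_coeff t \<theta> \<phi> s i) = c_const \<alpha> \<beta> * sinh (t / 2) *
     (pochhammer \<kappa> (2 * s) / fact (2 * s) * cosh (t / 2) powr (- \<kappa> - real (2 * s))) * even_binomial s p q"
    by (simp add: Psi_E_coeff_def even_binomial_def sum_distrib_left p_def q_def)
  also have "\<dots> \<le> c_const \<alpha> \<beta> * sinh (t / 2) *
     (pochhammer \<kappa> (2 * s) / fact (2 * s) * cosh (t / 2) powr (- \<kappa> - real (2 * s))) * 1"
    using c_const_pos \<alpha> \<beta> assms(1) e
    by (intro mult_left_mono mult_nonneg_nonneg divide_nonneg_nonneg pochhammer_nonneg) auto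
  finally have "(real s + 1)\<^sup>2 * (\<Sum>i\<le>s. Psi_E_coeff t \<theta> \<phi> s i) \<le> (real s + 1)\<^sup>2 * (c_const \<alpha> \<beta> * sinh (t / 2) *
     (pochhammer \<kappa> (2 * s) / fact (2 * s) * cosh (t / 2) powr (- \<kappa> - real (2 * s))))"
    by (intro mult_left_mono) auto
  moreover have "(real s + 1)\<^sup>2 * (\<Sum>i\<le>s. Psi_E_coeff t \<theta> \<phi> s i) \<ge> 0"
    using assms by (intro mult_nonneg_nonneg sum_nonneg Psi_E_coeff_nonneg) auto
  ultimately show "norm ((real s + 1)\<^sup>2 * (\<Sum>i\<le>s. Psi_E_coeff t \<theta> \<phi> s i)) \<le> c_const \<alpha> \<beta> * sinh (t / 2) * ?w s"
    by (simp add: mult_ac)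
qed

lemma Psi_E_sums:
  assumes "t > 0" "\<theta> \<in> {0..pi}" "\<phi> \<in> {0..pi}" "\<bar>u\<bar> \<le> 1" "\<bar>v\<bar> \<le> 1"
  shows "(\<lambda>s. \<Sum>i\<le>s. Psi_E_coeff t \<theta> \<phi> s i * (u ^ (2 * i) * v ^ (2 * (s - i)))) sums Psi_E \<alpha> \<beta> t \<theta> \<phi> u v"
proof -
  define p q where "p = sin (\<theta> / 2) * sin (\<phi> / 2)" and "q = cos (\<theta> / 2) * cos (\<phi> / 2)"
  have pq: "p \<ge> 0" "q \<ge> 0" "p + q \<le> 1"
    using half_angle_bound[OF assms(2,3)] by (auto simp: p_def q_def)
  define k where "k = cosh (t / 2)"
  have k: "k > 1"
    using cosh_half_gt_1[OF assms(1)] by (simp add: k_def)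
  define w where "w N = c_const \<alpha> \<beta> * sinh (t / 2) * (pochhammer \<kappa> N / fact N * k powr (- \<kappa> - real N))" for N
  have Psi: "(\<lambda>N. w N * (\<xi> * (u * p) + \<eta> * (v * q)) ^ N) sums Psi \<alpha> \<beta> t \<theta> \<phi> (\<xi> * u) (\<eta> * v)"
    if "\<bar>\<xi>\<bar> \<le> 1" "\<bar>\<eta>\<bar> \<le> 1" for \<xi> \<eta>
  proof -
    have "\<bar>\<xi> * u\<bar> \<le> 1" "\<bar>\<eta> * v\<bar> \<le> 1"
      using that assms(4,5) by (auto intro!: mult_le_one simp: abs_mult)
    then have "\<bar>\<xi> * u\<bar> * p \<le> 1 * p" "\<bar>\<eta> * v\<bar> * q \<le> 1 * q"
      using pq by (blast intro: mult_right_mono)+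
    then have "\<bar>\<xi> * u * p\<bar> \<le> p" "\<bar>\<eta> * v * q\<bar> \<le> q"
      using pq by (simp_all add: abs_mult)
    \<comment> \<open>The modulus is at most \<open>p + q \<le> 1 < cosh (t/2)\<close>: positivity
      of \<open>t\<close> keeps the binomial series convergent even for
      \<open>\<theta> = \<phi>\<close>.\<close>
    then have "\<bar>\<xi> * (u * p) + \<eta> * (v * q)\<bar> < k"
      using pq k by (simp add: mult.assoc)
    from sums_mult[OF negative_powr_sums[OF this, of \<kappa>], of "c_const \<alpha> \<beta> * sinh (t / 2)"]
    moreover have "cosh (t / 2) - 1 + q_fun \<theta> \<phi> (\<xi> * u) (\<eta> * v) = k - (\<xi> * (u * p) + \<eta> * (v * q))"
      by (simp add: q_fun_def k_def p_def q_def)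
    ultimately show ?thesis
      unfolding Psi_def w_def by (simp add: mult.assoc)
  qed
  have "(\<lambda>N. 1 / 4 * (\<Sum>\<xi>\<in>{-1, 1}. \<Sum>\<eta>\<in>{-1, 1}. w N * (\<xi> * (u * p) + \<eta> * (v * q)) ^ N)) sums Psi_E \<alpha> \<beta> t \<theta> \<phi> u v"
    unfolding Psi_E_def by (intro sums_mult sums_sum Psi) auto
  also have "(\<lambda>N. 1 / 4 * (\<Sum>\<xi>\<in>{-1, 1}. \<Sum>\<eta>\<in>{-1, 1}. w N * (\<xi> * (u * p) + \<eta> * (v * q)) ^ N)) =
      (\<lambda>N. if even N then w N * even_binomial (N div 2) (u * p) (v * q) else 0)"
    unfolding sum_distrib_left[symmetric] symmetrized_power by auto
  finally have "(\<lambda>N. if even N then w N * even_binomial (N div 2) (u * p) (v * q) else 0) sums Psi_E \<alpha> \<beta> t \<theta> \<phi> u v" .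
  then have "(\<lambda>s. if even (2 * s) then w (2 * s) * even_binomial (2 * s div 2) (u * p) (v * q) else 0) sums Psi_E \<alpha> \<beta> t \<theta> \<phi> u v"
    by (subst sums_mono_reindex[of "\<lambda>s. 2 * s"]) (auto simp: strict_mono_def image_def)
  then show ?thesis
    by (simp add: even_binomial_def Psi_E_coeff_def w_def p_def q_def k_def sum_distrib_left power_mult_distrib mult_ac)
qed

end

section \<open>Termwise integration\<close>

lemma (in pair_sigma_finite) has_bochner_integral_times:
  fixes f :: "'a \<Rightarrow> real" and g :: "'b \<Rightarrow> real"
  assumes f: "has_bochner_integral M1 f a" and g: "has_bochner_integral M2 g b"
  shows "has_bochner_integral (M1 \<Otimes>\<^sub>M M2) (\<lambda>p. f (fst p) * g (snd p)) (a * b)"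
proof -
  have [measurable]: "f \<in> borel_measurable M1" "g \<in> borel_measurable M2"
    using f g by (auto simp: has_bochner_integral_iff)
  have int: "integrable M1 f" "integrable M2 g" "integral\<^sup>L M1 f = a" "integral\<^sup>L M2 g = b"
    using f g by (auto simp: has_bochner_integral_iff)
  have i: "integrable (M1 \<Otimes>\<^sub>M M2) (\<lambda>p. f (fst p) * g (snd p))"
  proof (rule Fubini_integrable)
    show "integrable M1 (\<lambda>x. LINT y|M2. norm (f (fst (x, y)) * g (snd (x, y))))"
      using int by (simp add: abs_mult)
  qed (use int in auto)
  have "integral\<^sup>L (M1 \<Otimes>\<^sub>M M2) (\<lambda>p. f (fst p) * g (snd p)) = (LINT x|M1. LINT y|M2. f x * g y)"
    using integral_fst'[OF i] by simp
  also have "\<dots> = a * b"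
    using int by simp
  finally show ?thesis
    using i by (simp add: has_bochner_integral_iff)
qed

text \<open>The exchange rests on the summable integrals of the absolute values. \<open>W\<close>
  serves only pointwise convergence and may have infinite integral, as the density does for
  parameters below -1/2.\<close>

lemma has_bochner_integral_weighted_series:
  fixes G :: "nat \<Rightarrow> nat \<Rightarrow> 'a \<Rightarrow> real" and c :: "nat \<Rightarrow> nat \<Rightarrow> real"
  assumes c: "\<And>s i. c s i \<ge> 0" and sm: "summable (\<lambda>s. (real s + 1)\<^sup>2 * (\<Sum>i\<le>s. c s i))"
    and G: "\<And>s i. i \<le> s \<Longrightarrow> has_bochner_integral M (G s i) (I s i)"
    and absG: "\<And>s i. i \<le> s \<Longrightarrow> (LINT x|M. \<bar>G s i x\<bar>) \<le> C * (real s + 1)\<^sup>2"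
    and W: "\<And>s i x. \<bar>G s i x\<bar> \<le> W x"
  shows "has_bochner_integral M (\<lambda>x. \<Sum>s. \<Sum>i\<le>s. c s i * G s i x) (\<Sum>s. \<Sum>i\<le>s. c s i * I s i)"
    and "summable (\<lambda>s. \<Sum>i\<le>s. c s i * I s i)"
proof -
  define F where "F s x = (\<Sum>i\<le>s. c s i * G s i x)" for s x
  have F: "has_bochner_integral M (F s) (\<Sum>i\<le>s. c s i * I s i)" for s
    unfolding F_def by (intro has_bochner_integral_sum has_bochner_integral_mult_right G) auto
  have "\<bar>F s x\<bar> \<le> W x * ((real s + 1)\<^sup>2 * (\<Sum>i\<le>s. c s i))" for s x
  proof -
    have W0: "W x \<ge> 0"
      using W[of 0 0 x] by linarith
    have "\<bar>F s x\<bar> \<le> (\<Sum>i\<le>s. c s i * \<bar>G s i x\<bar>)"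
      unfolding F_def by (rule order_trans[OF sum_abs]) (simp add: abs_mult c)
    also have "\<dots> \<le> (\<Sum>i\<le>s. c s i * W x)"
      by (intro sum_mono mult_left_mono W c)
    also have "\<dots> = W x * (1 * (\<Sum>i\<le>s. c s i))"
      by (simp add: sum_distrib_left mult_ac)
    also have "\<dots> \<le> W x * ((real s + 1)\<^sup>2 * (\<Sum>i\<le>s. c s i))"
      using W0 by (intro mult_left_mono mult_right_mono sum_nonneg c) auto
    finally show ?thesis .
  qed
  then have 1: "summable (\<lambda>s. norm (F s x))" for x
    by (intro summable_comparison_test'[OF summable_mult[OF sm, of "W x"], of 0]) auto
  have abs: "(LINT x|M. \<bar>F s x\<bar>) \<le> C * ((real s + 1)\<^sup>2 * (\<Sum>i\<le>s. c s i))" for s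
  proof -
    have int: "integrable M (\<lambda>x. c s i * \<bar>G s i x\<bar>)" if "i \<le> s" for i
      using G[OF that] by (auto simp: has_bochner_integral_iff)
    have "(LINT x|M. \<bar>F s x\<bar>) \<le> (LINT x|M. (\<Sum>i\<le>s. c s i * \<bar>G s i x\<bar>))"
    proof (rule integral_mono)
      show "integrable M (\<lambda>x. \<bar>F s x\<bar>)"
        using F[of s] by (auto simp: has_bochner_integral_iff)
      show "integrable M (\<lambda>x. \<Sum>i\<le>s. c s i * \<bar>G s i x\<bar>)"
        using int by (intro Bochner_Integration.integrable_sum) auto
      show "\<bar>F s x\<bar> \<le> (\<Sum>i\<le>s. c s i * \<bar>G s i x\<bar>)" for x
        unfolding F_def by (rule order_trans[OF sum_abs]) (simp add: abs_mult c)
    qed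
    also have "\<dots> = (\<Sum>i\<le>s. c s i * (LINT x|M. \<bar>G s i x\<bar>))"
      using int by (subst Bochner_Integration.integral_sum) auto
    also have "\<dots> \<le> (\<Sum>i\<le>s. c s i * (C * (real s + 1)\<^sup>2))"
      by (intro sum_mono mult_left_mono absG c) auto
    finally show ?thesis
      by (simp add: sum_distrib_left sum_distrib_right mult_ac)
  qed
  have 2: "summable (\<lambda>s. LINT x|M. norm (F s x))"
    by (rule summable_comparison_test'[OF summable_mult[OF sm, of C], of 0])
       (use abs in \<open>simp add: integral_nonneg_AE\<close>)
  have 3: "integrable M (F s)" "integral\<^sup>L M (F s) = (\<Sum>i\<le>s. c s i * I s i)" for s
    using F[of s] by (auto simp: has_bochner_integral_iff)
  have "integrable M (\<lambda>x. \<Sum>s. F s x)" "(\<lambda>s. integral\<^sup>L M (F s)) sums (LINT x|M. (\<Sum>s. F s x))"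
    by (intro integrable_suminf sums_integral 3(1) 2 AE_I2 1)+
  then show "has_bochner_integral M (\<lambda>x. \<Sum>s. \<Sum>i\<le>s. c s i * G s i x) (\<Sum>s. \<Sum>i\<le>s. c s i * I s i)"
    and "summable (\<lambda>s. \<Sum>i\<le>s. c s i * I s i)"
    unfolding 3(2) by (simp_all add: has_bochner_integral_iff sums_iff F_def)
qed

section \<open>The series with moments is the Poisson kernel\<close>

context jacobi
begin

lemma Psi_E_coeff_Pi_moment_summable:
  assumes "t > 0" "\<theta> \<in> {0..pi}" "\<phi> \<in> {0..pi}"
  shows "summable (\<lambda>s. \<Sum>i\<le>s. Psi_E_coeff t \<theta> \<phi> s i * (Pi_moment \<alpha> i * Pi_moment \<beta> (s - i)))"
proof (rule summable_comparison_test'[OF summable_mult[OF Psi_E_coeff_summable[OF assms], of "(1 + 1 / (\<alpha> + 1)) * (1 + 1 / (\<beta> + 1))"], of 0])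
  fix s :: nat
  let ?K = "\<lambda>\<gamma>. 1 + 1 / (\<gamma> + 1)"
  have K: "?K \<alpha> \<ge> 0" "?K \<beta> \<ge> 0"
    using \<alpha> \<beta> by auto
  have M: "Pi_moment \<gamma> i \<le> ?K \<gamma> * (real s + 1)" if "\<gamma> > -1" "i \<le> s" for \<gamma> i
    using that by (intro order_trans[OF Pi_moment_le]) (auto intro!: mult_left_mono)
  have nn: "Psi_E_coeff t \<theta> \<phi> s i * (Pi_moment \<alpha> i * Pi_moment \<beta> (s - i)) \<ge> 0" for i
    using assms \<alpha> \<beta> by (intro mult_nonneg_nonneg Psi_E_coeff_nonneg Pi_moment_nonneg) auto
  have "(\<Sum>i\<le>s. Psi_E_coeff t \<theta> \<phi> s i * (Pi_moment \<alpha> i * Pi_moment \<beta> (s - i))) \<le>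
      (\<Sum>i\<le>s. Psi_E_coeff t \<theta> \<phi> s i * ((?K \<alpha> * (real s + 1)) * (?K \<beta> * (real s + 1))))"
    using assms \<alpha> \<beta> K by (intro sum_mono mult_left_mono mult_mono M Psi_E_coeff_nonneg Pi_moment_nonneg mult_nonneg_nonneg) auto
  also have "\<dots> = ?K \<alpha> * ?K \<beta> * ((real s + 1)\<^sup>2 * (\<Sum>i\<le>s. Psi_E_coeff t \<theta> \<phi> s i))"
    unfolding sum_distrib_left by (rule sum.cong[OF refl]) (simp add: power2_eq_square mult_ac)
  finally show "norm (\<Sum>i\<le>s. Psi_E_coeff t \<theta> \<phi> s i * (Pi_moment \<alpha> i * Pi_moment \<beta> (s - i))) \<le>
      ?K \<alpha> * ?K \<beta> * ((real s + 1)\<^sup>2 * (\<Sum>i\<le>s. Psi_E_coeff t \<theta> \<phi> s i))"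
    using nn by (simp add: sum_nonneg)
qed

text \<open>Since \<open>(2i)! = 4^i (1/2)_i i!\<close>, the moments cancel the half-integer
  Pochhammer symbols, and the denominators of \<open>bcoeff\<close> remain. The leftover
  \<open>4^s\<close> joins \<open>k^(-2s)\<close> to form \<open>X^s\<close>.\<close>

lemma Psi_E_coeff_Pi_moment:
  assumes "t > 0" "\<theta> \<in> {0..pi}" "\<phi> \<in> {0..pi}"
  defines "X \<equiv> exp (- t) / (1 + exp (- t))\<^sup>2"
  shows "(\<Sum>i\<le>s. Psi_E_coeff t \<theta> \<phi> s i * (Pi_moment \<alpha> i * Pi_moment \<beta> (s - i))) =
    2 powr (1 - \<kappa>) * sinh (t / 2) * cosh (t / 2) powr (- \<kappa>) * (kernel_coeff ((1 - cos \<theta>) / 2) ((1 - cos \<phi>) / 2) s * X ^ s)"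
proof -
  define a b where "a = (1 - cos \<theta>) / 2" and "b = (1 - cos \<phi>) / 2"
  define k where "k = cosh (t / 2)"
  have k: "k > 0"
    by (simp add: k_def)
  have X: "X = 1 / (4 * k\<^sup>2)"
  proof -
    have "1 + exp (- t) = exp (- t / 2) * (2 * k)"
      by (simp add: k_def cosh_def algebra_simps flip: exp_add)
    then have "(1 + exp (- t))\<^sup>2 = exp (- t) * (4 * k\<^sup>2)"
      by (simp add: power_mult_distrib flip: exp_double)
    then show ?thesis
      by (simp add: X_def)
  qed
  have ab: "(sin (\<theta> / 2))\<^sup>2 = a" "(sin (\<phi> / 2))\<^sup>2 = b" "(cos (\<theta> / 2))\<^sup>2 = 1 - a" "(cos (\<phi> / 2))\<^sup>2 = 1 - b"
    using cos_double_sin[of "\<theta> / 2"] cos_double_sin[of "\<phi> / 2"]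
    by (auto simp: a_def b_def cos_squared_eq)
  define E where "E = c_const \<alpha> \<beta> * sinh (t / 2) * k powr (- \<kappa>) / Gamma \<kappa> * Gamma (\<kappa> + 2 * real s) * X ^ s"
  have Gk: "Gamma \<kappa> \<noteq> 0"
    using Gamma_pos(3)[of 0] by (simp del: Gamma_pos)
  have poch: "pochhammer \<kappa> (2 * s) = Gamma (\<kappa> + 2 * real s) / Gamma \<kappa>"
    using Gamma_add_nat[of \<kappa> "2 * s"] Gk \<alpha> \<beta> by (simp add: field_simps)
  have kp: "k powr (- \<kappa> - real (2 * s)) = k powr (- \<kappa>) * (4 ^ s * X ^ s)"
    using k powr_realpow[OF k, of "2 * s", unfolded power_mult]
    by (simp add: powr_diff X power_divide power_mult_distrib)
  have "Psi_E_coeff t \<theta> \<phi> s i * (Pi_moment \<alpha> i * Pi_moment \<beta> (s - i)) =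
      E * (bcoeff s b (1 - b) i * (a ^ i * (1 - a) ^ (s - i)))" if i: "i \<le> s" for i
  proof -
    define j where "j = s - i"
    have s: "s = i + j"
      using i by (simp add: j_def)
    have "(sin (\<theta> / 2) * sin (\<phi> / 2)) ^ (2 * i) = (a * b) ^ i"
      by (simp add: power_mult power_mult_distrib ab)
    moreover have "(cos (\<theta> / 2) * cos (\<phi> / 2)) ^ (2 * j) = ((1 - a) * (1 - b)) ^ j"
      by (simp add: power_mult power_mult_distrib ab)
    moreover have "real (2 * s choose (2 * i)) = fact (2 * s) / (fact (2 * i) * fact (2 * j))"
      using i binomial_fact[of "2 * i" "2 * s", where ?'a = real] by (simp add: j_def flip: diff_mult_distrib2)
    ultimately have e: "Psi_E_coeff t \<theta> \<phi> s i = E * 4 ^ s * ((a * b) ^ i * ((1 - a) * (1 - b)) ^ j) / (fact (2 * i) * fact (2 * j))"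
      unfolding Psi_E_coeff_def E_def poch kp[unfolded k_def] k_def j_def[symmetric] by (simp add: mult_ac)
    have nz: "pochhammer (1 / 2 :: real) i \<noteq> 0" "pochhammer (1 / 2 :: real) j \<noteq> 0"
      using pochhammer_pos[of "1 / 2 :: real"] by (metis less_irrefl half_gt_zero zero_less_one)+
    have f4: "(fact (2 * m) :: real) = 4 ^ m * pochhammer (1 / 2) m * fact m" for m
      by (simp add: fact_double power_mult)
    show ?thesis
      unfolding e f4 Pi_moment_def bcoeff_def j_def[symmetric] using nz
      by (simp add: s power_add power_mult_distrib mult_ac)
  qed
  then have "(\<Sum>i\<le>s. Psi_E_coeff t \<theta> \<phi> s i * (Pi_moment \<alpha> i * Pi_moment \<beta> (s - i))) = E * poly (bsum s b (1 - b)) a"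
    by (simp add: poly_bsum sum_distrib_left)
  also have "\<dots> = 2 powr (1 - \<kappa>) * sinh (t / 2) * k powr (- \<kappa>) * (kernel_coeff a b s * X ^ s)"
    using Gk by (simp add: E_def kernel_coeff_def c_const_def powr_diff powr_add powr_minus field_simps)
  finally show ?thesis
    by (simp add: a_def b_def k_def)
qed

lemma jacobi_kernel_sums:
  assumes "t > 0" "\<theta> \<in> {0..pi}" "\<phi> \<in> {0..pi}"
  shows "jacobi_kernel_term \<alpha> \<beta> t \<theta> \<phi> sums
    (\<Sum>s. \<Sum>i\<le>s. Psi_E_coeff t \<theta> \<phi> s i * (Pi_moment \<alpha> i * Pi_moment \<beta> (s - i)))"
proof -
  define r X where "r = exp (- t)" and "X = exp (- t) / (1 + exp (- t))\<^sup>2"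
  define k where "k = cosh (t / 2)"
  define a where "a x = (1 - cos x) / 2" for x :: real
  define F where "F = 2 powr (1 - \<kappa>) * sinh (t / 2) * k powr (- \<kappa>)"
  have r: "0 < r" "r < 1" and k: "k > 0"
    using assms by (auto simp: r_def k_def)
  have F: "F > 0"
    using assms k by (simp add: F_def)
  \<comment> \<open>For arbitrary angles, because the convergence argument also uses the pairs
    \<open>(\<theta>, \<theta>)\<close> and \<open>(\<phi>, \<phi>)\<close>.\<close>
  have E: "(\<Sum>i\<le>s. Psi_E_coeff t \<theta> \<phi> s i * (Pi_moment \<alpha> i * Pi_moment \<beta> (s - i))) = F * (kernel_coeff (a \<theta>) (a \<phi>) s * X ^ s)"
    if "\<theta> \<in> {0..pi}" "\<phi> \<in> {0..pi}" for \<theta> \<phi> s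
    using Psi_E_coeff_Pi_moment[OF assms(1) that] by (simp add: F_def X_def k_def a_def)
  have sm: "summable (\<lambda>s. kernel_coeff (a \<theta>) (a \<phi>) s * X ^ s)" if "\<theta> \<in> {0..pi}" "\<phi> \<in> {0..pi}" for \<theta> \<phi>
    using Psi_E_coeff_Pi_moment_summable[OF assms(1) that] F unfolding E[OF that] by (simp add: summable_cmult_iff)
  have "(\<lambda>n. jacobi_product (a \<theta>) (a \<phi>) n * r ^ n) sums ((1 - r) / (1 + r) powr \<kappa> * (\<Sum>s. kernel_coeff (a \<theta>) (a \<phi>) s * X ^ s))"
    using jacobi_product_sums[OF r, of "a \<theta>" "a \<phi>"] sm assms by (simp add: X_def r_def)
  from sums_mult[OF this, of "exp (- t * ((\<alpha> + \<beta> + 1) / 2))"]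
  have "(\<lambda>n. exp (- t * ((\<alpha> + \<beta> + 1) / 2)) * (jacobi_product (a \<theta>) (a \<phi>) n * r ^ n)) sums
      (exp (- t * ((\<alpha> + \<beta> + 1) / 2)) * ((1 - r) / (1 + r) powr \<kappa>) * (\<Sum>s. kernel_coeff (a \<theta>) (a \<phi>) s * X ^ s))"
    by (simp add: mult_ac)
  \<comment> \<open>Both \<open>1 - r\<close> and \<open>1 + r\<close> contain
    \<open>exp (- t / 2)\<close>; these exponentials cancel because
    \<open>(\<alpha> + \<beta> + 1) + 1 = \<kappa>\<close>.\<close>
  also have "exp (- t * ((\<alpha> + \<beta> + 1) / 2)) * ((1 - r) / (1 + r) powr \<kappa>) = F"
  proof -
    have "1 - r = exp (- t / 2) * (2 * sinh (t / 2))"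
      by (simp add: r_def sinh_def algebra_simps flip: exp_add)
    moreover have "1 + r = exp (- t / 2) * (2 * k)"
      by (simp add: r_def k_def cosh_def algebra_simps flip: exp_add)
    then have "(1 + r) powr \<kappa> = exp (- t / 2 * \<kappa>) * (2 powr \<kappa> * k powr \<kappa>)"
      using k by (simp add: powr_mult exp_powr_real)
    moreover have "exp (- t * ((\<alpha> + \<beta> + 1) / 2)) * exp (- t / 2) = exp (- t / 2 * \<kappa>)"
      by (simp add: field_simps flip: exp_add)
    ultimately have "exp (- t * ((\<alpha> + \<beta> + 1) / 2)) * ((1 - r) / (1 + r) powr \<kappa>) =
       exp (- t / 2 * \<kappa>) * (2 * sinh (t / 2)) / (exp (- t / 2 * \<kappa>) * (2 powr \<kappa> * k powr \<kappa>))"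
      by (simp add: mult.assoc[symmetric])
    also have "\<dots> = 2 * sinh (t / 2) / (2 powr \<kappa> * k powr \<kappa>)"
      by simp
    also have "\<dots> = F"
      unfolding F_def powr_diff powr_minus_divide by simp
    finally show ?thesis .
  qed
  also have "F * (\<Sum>s. kernel_coeff (a \<theta>) (a \<phi>) s * X ^ s) = (\<Sum>s. \<Sum>i\<le>s. Psi_E_coeff t \<theta> \<phi> s i * (Pi_moment \<alpha> i * Pi_moment \<beta> (s - i)))"
    unfolding E[OF assms(2,3)] by (rule suminf_mult[OF sm[OF assms(2,3)], symmetric])
  also have "(\<lambda>n. exp (- t * ((\<alpha> + \<beta> + 1) / 2)) * (jacobi_product (a \<theta>) (a \<phi>) n * r ^ n)) = jacobi_kernel_term \<alpha> \<beta> t \<theta> \<phi>"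
  proof
    fix n
    define p where "p = pochhammer (\<alpha> + 1) n * pochhammer (\<beta> + 1) n"
    have p: "p > 0"
      by (simp add: p_def)
    have P: "jacobi_poly \<alpha> \<beta> n (cos x) = p * poly (jacobi_pol n) (a x)" for x
    proof -
      have "1 - 2 * a x = cos x"
        by (simp add: a_def field_simps)
      then show ?thesis
        using jacobi_poly_eq[of n "a x"] by (simp add: p_def)
    qed
    have "(LINT \<phi>|jacobi_measure \<alpha> \<beta>. (jacobi_poly \<alpha> \<beta> n (cos \<phi>))\<^sup>2) = p\<^sup>2 * jacobi_sqnorm n"
      by (simp add: P power_mult_distrib jacobi_sqnorm_def a_def)
    then have "jacobi_trig \<alpha> \<beta> n x = poly (jacobi_pol n) (a x) / sqrt (jacobi_sqnorm n)" for x
      using p by (simp add: jacobi_trig_def P real_sqrt_mult)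
    then have "jacobi_trig \<alpha> \<beta> n \<theta> * jacobi_trig \<alpha> \<beta> n \<phi> = jacobi_product (a \<theta>) (a \<phi>) n"
      using jacobi_sqnorm_pos[of n] by (simp add: jacobi_product_def)
    moreover have "exp (- t * (real n + (\<alpha> + \<beta> + 1) / 2)) = exp (- t * ((\<alpha> + \<beta> + 1) / 2)) * r ^ n"
      by (simp add: r_def algebra_simps flip: exp_add exp_of_nat_mult)
    ultimately show "exp (- t * ((\<alpha> + \<beta> + 1) / 2)) * (jacobi_product (a \<theta>) (a \<phi>) n * r ^ n) = jacobi_kernel_term \<alpha> \<beta> t \<theta> \<phi> n"
      unfolding jacobi_kernel_term_def by (simp add: mult_ac)
  qed
  finally show ?thesis .
qed

end

text \<open>Summability and integrability belong to the conclusion because \<open>suminf\<close> and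
  the Bochner integral are total functions, so the equation alone would not assert
  convergence.\<close>

theorem theorem2p1:
  fixes \<alpha> \<beta> t \<theta> \<phi> :: real
  assumes "\<alpha> > -1" and "\<beta> > -1" and "t > 0"
    and "\<theta> \<in> {0..pi}" and "\<phi> \<in> {0..pi}"
  shows "summable (jacobi_kernel_term \<alpha> \<beta> t \<theta> \<phi>)
    \<and> Pi_integrable2 \<alpha> \<beta> ({0<..1} \<times> {0<..1})
           (\<lambda>u v. Psi_E \<alpha> \<beta> t \<theta> \<phi> u v - Psi_E \<alpha> \<beta> t \<theta> \<phi> u 1
                  - Psi_E \<alpha> \<beta> t \<theta> \<phi> 1 v + Psi_E \<alpha> \<beta> t \<theta> \<phi> 1 1)
    \<and> Pi_integrable \<alpha> {0<..1} (\<lambda>u. Psi_E \<alpha> \<beta> t \<theta> \<phi> u 1 - Psi_E \<alpha> \<beta> t \<theta> \<phi> 1 1)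
    \<and> Pi_integrable \<beta> {0<..1} (\<lambda>v. Psi_E \<alpha> \<beta> t \<theta> \<phi> 1 v - Psi_E \<alpha> \<beta> t \<theta> \<phi> 1 1)
    \<and> jacobi_kernel \<alpha> \<beta> t \<theta> \<phi> =
           4 * Pi_integral2 \<alpha> \<beta> ({0<..1} \<times> {0<..1})
             (\<lambda>u v. Psi_E \<alpha> \<beta> t \<theta> \<phi> u v - Psi_E \<alpha> \<beta> t \<theta> \<phi> u 1
                    - Psi_E \<alpha> \<beta> t \<theta> \<phi> 1 v + Psi_E \<alpha> \<beta> t \<theta> \<phi> 1 1)
         + 2 * Pi_integral \<alpha> {0<..1} (\<lambda>u. Psi_E \<alpha> \<beta> t \<theta> \<phi> u 1 - Psi_E \<alpha> \<beta> t \<theta> \<phi> 1 1)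
         + 2 * Pi_integral \<beta> {0<..1} (\<lambda>v. Psi_E \<alpha> \<beta> t \<theta> \<phi> 1 v - Psi_E \<alpha> \<beta> t \<theta> \<phi> 1 1)
         + Psi_E \<alpha> \<beta> t \<theta> \<phi> 1 1"
proof -
  interpret jacobi \<alpha> \<beta>
    using assms by unfold_locales
  interpret P: pair_sigma_finite "Pi_ref \<alpha>" "Pi_ref \<beta>"
    using sigma_finite_Pi_ref by (simp add: pair_sigma_finite_def)
  let ?P = "Psi_E \<alpha> \<beta> t \<theta> \<phi>"
  define e where "e = Psi_E_coeff t \<theta> \<phi>"
  define g where "g \<gamma> i u = indicator {0<..1} u * ((1 - u ^ (2 * i)) * Pi_density \<gamma> u)" for \<gamma> i u
  define I where "I \<gamma> i = (1 - Pi_moment \<gamma> i) / 2" for \<gamma> i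
  define K where "K \<gamma> = 1 + 1 / (\<gamma> + 1)" for \<gamma> :: real
  have e: "e s i \<ge> 0" and sm: "summable (\<lambda>s. (real s + 1)\<^sup>2 * (\<Sum>i\<le>s. e s i))" for s i
    using assms by (auto simp: e_def intro: Psi_E_coeff_nonneg Psi_E_coeff_summable)
  have g: "has_bochner_integral (Pi_ref \<gamma>) (g \<gamma> i) (I \<gamma> i)"
    and absg: "has_bochner_integral (Pi_ref \<gamma>) (\<lambda>u. \<bar>g \<gamma> i u\<bar>) \<bar>I \<gamma> i\<bar>" if "\<gamma> > -1" for \<gamma> i
    using Pi_integral_power[OF that] Pi_integral_abs_power[OF that] by (simp_all add: g_def[abs_def] I_def)
  have K: "K \<gamma> \<ge> 0" if "\<gamma> > -1" for \<gamma>
    using that by (simp add: K_def)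
  have I: "\<bar>I \<gamma> i\<bar> \<le> K \<gamma> * (real s + 1)" if "\<gamma> > -1" "i \<le> s" for \<gamma> i s
    using abs_one_minus_Pi_moment_le[OF that] by (simp add: I_def K_def)
  \<comment> \<open>The single integrals grow linearly, but the common exchange lemma has the
    quadratic weight of the double integral.\<close>
  have I2: "\<bar>I \<gamma> i\<bar> \<le> K \<gamma> * (real s + 1)\<^sup>2" if "\<gamma> > -1" "i \<le> s" for \<gamma> i s
  proof -
    have "K \<gamma> * (real s + 1) \<le> K \<gamma> * (real s + 1)\<^sup>2"
      using K[OF that(1)] by (intro mult_left_mono self_le_power) auto
    with I[OF that] show ?thesis
      by linarith
  qed
  have W: "\<bar>g \<gamma> i u\<bar> \<le> \<bar>indicator {0<..1} u * Pi_density \<gamma> u\<bar>" for \<gamma> i u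
  proof (cases "u \<in> {0<..1}")
    case True
    then have "0 \<le> 1 - u ^ (2 * i)" "1 - u ^ (2 * i) \<le> 1"
      by (auto simp: power_le_one)
    then have "\<bar>1 - u ^ (2 * i)\<bar> * \<bar>Pi_density \<gamma> u\<bar> \<le> 1 * \<bar>Pi_density \<gamma> u\<bar>"
      by (intro mult_right_mono) auto
    with True show ?thesis
      by (simp add: g_def abs_mult)
  qed (simp add: g_def)
  have P: "(\<lambda>s. \<Sum>i\<le>s. e s i * (u ^ (2 * i) * v ^ (2 * (s - i)))) sums ?P u v" if "u \<in> {0<..1}" "v \<in> {0<..1}" for u v
    unfolding e_def using assms that by (intro Psi_E_sums) auto
  have one: "(1::real) \<in> {0<..1}"
    by simp

  have A: "has_bochner_integral (Pi_ref \<alpha>) (\<lambda>u. \<Sum>s. \<Sum>i\<le>s. e s i * g \<alpha> i u) (\<Sum>s. \<Sum>i\<le>s. e s i * I \<alpha> i)"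
    "summable (\<lambda>s. \<Sum>i\<le>s. e s i * I \<alpha> i)"
    by (rule has_bochner_integral_weighted_series[OF e sm, where M = "Pi_ref \<alpha>" and
        G = "\<lambda>s i. g \<alpha> i" and C = "K \<alpha>" and W = "\<lambda>u. \<bar>indicator {0<..1} u * Pi_density \<alpha> u\<bar>"]; use assms in
      \<open>simp add: g W I2 has_bochner_integral_integral_eq[OF absg]\<close>)+
  \<comment> \<open>The minus sign arises because \<open>g\<close> is built on
    \<open>1 - u^(2i)\<close>; in the double integral the two signs cancel.\<close>
  have A': "(\<Sum>s. \<Sum>i\<le>s. e s i * g \<alpha> i u) = - (indicator {0<..1} u *\<^sub>R ((?P u 1 - ?P 1 1) * Pi_density \<alpha> u))" for u
  proof (cases "u \<in> {0<..1}")
    case True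
    have "(\<lambda>s. (\<Sum>i\<le>s. e s i * (1 ^ (2 * i) * 1 ^ (2 * (s - i)))) - (\<Sum>i\<le>s. e s i * (u ^ (2 * i) * 1 ^ (2 * (s - i))))) sums (?P 1 1 - ?P u 1)"
      by (intro sums_diff P True one)
    from sums_mult2[OF this, of "Pi_density \<alpha> u"]
    have "(\<lambda>s. \<Sum>i\<le>s. e s i * g \<alpha> i u) sums ((?P 1 1 - ?P u 1) * Pi_density \<alpha> u)"
      unfolding sum_subtractf[symmetric] sum.distrib[symmetric] sum_distrib_right
      by (rule sums_cong[THEN iffD1, rotated])
         (rule sum.cong[OF refl], use True in \<open>simp add: g_def algebra_simps\<close>)
    then show ?thesis
      using True by (simp add: sums_iff algebra_simps)
  qed (simp add: g_def)
  have B: "has_bochner_integral (Pi_ref \<beta>) (\<lambda>v. \<Sum>s. \<Sum>i\<le>s. e s i * g \<beta> (s - i) v) (\<Sum>s. \<Sum>i\<le>s. e s i * I \<beta> (s - i))"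
    "summable (\<lambda>s. \<Sum>i\<le>s. e s i * I \<beta> (s - i))"
    by (rule has_bochner_integral_weighted_series[OF e sm, where M = "Pi_ref \<beta>" and
        G = "\<lambda>s i. g \<beta> (s - i)" and C = "K \<beta>" and W = "\<lambda>u. \<bar>indicator {0<..1} u * Pi_density \<beta> u\<bar>"]; use assms in
      \<open>simp add: g W I2 has_bochner_integral_integral_eq[OF absg]\<close>)+
  have B': "(\<Sum>s. \<Sum>i\<le>s. e s i * g \<beta> (s - i) v) = - (indicator {0<..1} v *\<^sub>R ((?P 1 v - ?P 1 1) * Pi_density \<beta> v))" for v
  proof (cases "v \<in> {0<..1}")
    case True
    have "(\<lambda>s. (\<Sum>i\<le>s. e s i * (1 ^ (2 * i) * 1 ^ (2 * (s - i)))) - (\<Sum>i\<le>s. e s i * (1 ^ (2 * i) * v ^ (2 * (s - i))))) sums (?P 1 1 - ?P 1 v)"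
      by (intro sums_diff P True one)
    from sums_mult2[OF this, of "Pi_density \<beta> v"]
    have "(\<lambda>s. \<Sum>i\<le>s. e s i * g \<beta> (s - i) v) sums ((?P 1 1 - ?P 1 v) * Pi_density \<beta> v)"
      unfolding sum_subtractf[symmetric] sum.distrib[symmetric] sum_distrib_right
      by (rule sums_cong[THEN iffD1, rotated])
         (rule sum.cong[OF refl], use True in \<open>simp add: g_def algebra_simps\<close>)
    then show ?thesis
      using True by (simp add: sums_iff algebra_simps)
  qed (simp add: g_def)
  have absgg: "(LINT p|(Pi_ref \<alpha> \<Otimes>\<^sub>M Pi_ref \<beta>). \<bar>g \<alpha> i (fst p) * g \<beta> (s - i) (snd p)\<bar>) \<le> K \<alpha> * K \<beta> * (real s + 1)\<^sup>2"
    if "i \<le> s" for s i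
  proof -
    have "(LINT p|(Pi_ref \<alpha> \<Otimes>\<^sub>M Pi_ref \<beta>). \<bar>g \<alpha> i (fst p) * g \<beta> (s - i) (snd p)\<bar>) = \<bar>I \<alpha> i\<bar> * \<bar>I \<beta> (s - i)\<bar>"
      unfolding abs_mult using assms by (intro has_bochner_integral_integral_eq P.has_bochner_integral_times absg)
    also have "\<dots> \<le> (K \<alpha> * (real s + 1)) * (K \<beta> * (real s + 1))"
      using assms that K by (intro mult_mono I mult_nonneg_nonneg) auto
    finally show ?thesis
      by (simp add: power2_eq_square mult_ac)
  qed
  have absgg_le: "\<bar>g \<alpha> i (fst p) * g \<beta> j (snd p)\<bar> \<le>
      \<bar>indicator {0<..1} (fst p) * Pi_density \<alpha> (fst p)\<bar> * \<bar>indicator {0<..1} (snd p) * Pi_density \<beta> (snd p)\<bar>" for i j p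
    unfolding abs_mult[of "g _ _ _"] by (intro mult_mono W abs_ge_zero)
  have D: "has_bochner_integral (Pi_ref \<alpha> \<Otimes>\<^sub>M Pi_ref \<beta>)
      (\<lambda>p. \<Sum>s. \<Sum>i\<le>s. e s i * (g \<alpha> i (fst p) * g \<beta> (s - i) (snd p))) (\<Sum>s. \<Sum>i\<le>s. e s i * (I \<alpha> i * I \<beta> (s - i)))"
    "summable (\<lambda>s. \<Sum>i\<le>s. e s i * (I \<alpha> i * I \<beta> (s - i)))"
    by (rule has_bochner_integral_weighted_series[OF e sm, where M = "Pi_ref \<alpha> \<Otimes>\<^sub>M Pi_ref \<beta>" and C = "K \<alpha> * K \<beta>" and
        G = "\<lambda>s i p. g \<alpha> i (fst p) * g \<beta> (s - i) (snd p)" and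
        W = "\<lambda>p. \<bar>indicator {0<..1} (fst p) * Pi_density \<alpha> (fst p)\<bar> * \<bar>indicator {0<..1} (snd p) * Pi_density \<beta> (snd p)\<bar>"];
      use assms in \<open>auto simp only: intro!: P.has_bochner_integral_times g absgg absgg_le\<close>)+
  have D': "(\<Sum>s. \<Sum>i\<le>s. e s i * (g \<alpha> i (fst p) * g \<beta> (s - i) (snd p))) =
     indicator ({0<..1} \<times> {0<..1}) p *\<^sub>R (case p of (u, v) \<Rightarrow> (?P u v - ?P u 1 - ?P 1 v + ?P 1 1) * Pi_density \<alpha> u * Pi_density \<beta> v)" for p
  proof (cases "p \<in> {0<..1} \<times> {0<..1}")
    case True
    then obtain u v where p: "p = (u, v)" and uv: "u \<in> {0<..1}" "v \<in> {0<..1}"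
      by auto
    have "(\<lambda>s. (\<Sum>i\<le>s. e s i * (u ^ (2 * i) * v ^ (2 * (s - i)))) - (\<Sum>i\<le>s. e s i * (u ^ (2 * i) * 1 ^ (2 * (s - i))))
        - (\<Sum>i\<le>s. e s i * (1 ^ (2 * i) * v ^ (2 * (s - i)))) + (\<Sum>i\<le>s. e s i * (1 ^ (2 * i) * 1 ^ (2 * (s - i)))))
        sums (?P u v - ?P u 1 - ?P 1 v + ?P 1 1)"
      by (intro sums_add sums_diff P uv one)
    from sums_mult2[OF this, of "Pi_density \<alpha> u * Pi_density \<beta> v"]
    have "(\<lambda>s. \<Sum>i\<le>s. e s i * (g \<alpha> i u * g \<beta> (s - i) v)) sums ((?P u v - ?P u 1 - ?P 1 v + ?P 1 1) * (Pi_density \<alpha> u * Pi_density \<beta> v))"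
      unfolding sum_subtractf[symmetric] sum.distrib[symmetric] sum_distrib_right
      by (rule sums_cong[THEN iffD1, rotated])
         (rule sum.cong[OF refl], use uv in \<open>simp add: g_def algebra_simps\<close>)
    then show ?thesis
      using uv by (simp add: p sums_iff mult_ac)
  qed (auto simp: g_def indicator_def mem_Times_iff)

  have S: "(\<lambda>s. \<Sum>i\<le>s. e s i) sums ?P 1 1"
    using P[OF one one] by simp
  have "(\<lambda>s. 4 * (\<Sum>i\<le>s. e s i * (I \<alpha> i * I \<beta> (s - i))) - 2 * (\<Sum>i\<le>s. e s i * I \<alpha> i) - 2 * (\<Sum>i\<le>s. e s i * I \<beta> (s - i)) + (\<Sum>i\<le>s. e s i))
     sums (4 * (\<Sum>s. \<Sum>i\<le>s. e s i * (I \<alpha> i * I \<beta> (s - i))) - 2 * (\<Sum>s. \<Sum>i\<le>s. e s i * I \<alpha> i) - 2 * (\<Sum>s. \<Sum>i\<le>s. e s i * I \<beta> (s - i)) + ?P 1 1)"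
    by (intro sums_add sums_diff sums_mult summable_sums A B D S)
  \<comment> \<open>Termwise this is \<open>(1 - 2 I) (1 - 2 J)\<close>, and \<open>1 - 2 I\<close>
    is the moment.\<close>
  moreover have "4 * (\<Sum>i\<le>s. e s i * (I \<alpha> i * I \<beta> (s - i))) - 2 * (\<Sum>i\<le>s. e s i * I \<alpha> i) - 2 * (\<Sum>i\<le>s. e s i * I \<beta> (s - i)) + (\<Sum>i\<le>s. e s i)
      = (\<Sum>i\<le>s. Psi_E_coeff t \<theta> \<phi> s i * (Pi_moment \<alpha> i * Pi_moment \<beta> (s - i)))" for s
    unfolding sum_distrib_left sum_subtractf[symmetric] sum.distrib[symmetric]
    by (rule sum.cong[OF refl]) (simp add: e_def I_def field_simps)
  ultimately have "jacobi_kernel \<alpha> \<beta> t \<theta> \<phi> = 4 * (\<Sum>s. \<Sum>i\<le>s. e s i * (I \<alpha> i * I \<beta> (s - i))) - 2 * (\<Sum>s. \<Sum>i\<le>s. e s i * I \<alpha> i)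
      - 2 * (\<Sum>s. \<Sum>i\<le>s. e s i * I \<beta> (s - i)) + ?P 1 1"
    using jacobi_kernel_sums[OF assms(3-5)] by (simp add: jacobi_kernel_def sums_iff)
  moreover have "summable (jacobi_kernel_term \<alpha> \<beta> t \<theta> \<phi>)"
    using jacobi_kernel_sums[OF assms(3-5)] by (simp add: sums_iff)
  ultimately show ?thesis
    using A(1) B(1) D(1) unfolding A' B' D'
    by (simp add: Pi_integrable_def Pi_integral_def Pi_integrable2_def Pi_integral2_def
        set_integrable_def set_lebesgue_integral_def has_bochner_integral_iff)
qed

end
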